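(* Let $p$ be a prime and let $\alpha, \beta \in \mathbb{C}_p$ with $0<|\beta|<1<|\alpha|$. Then for each integer $k \geq 1$, \[ m_{p,k}((t-\alpha)(t-\beta)) = \log_p^k \alpha + \sum_{\substack{i+j\le k\\ i,j\ge 1}} (-1)^{i+j}\frac{k!}{(k-i-j)!}\left(\log_p^{k-i-j}\alpha\right)\operatorname{Li}_{(\{1\}^{i-1}\ast\{1\}^{j-1},\,2)}\!\left(\frac{\beta}{\alpha}\right). \]
   Context: $\mathbb{C}_p$ is the completion of an algebraic closure of $\mathbb{Q}_p$, with absolute value $|\cdot|$ normalized by $|p|=p^{-1}$. Fix the decomposition $\mathbb{C}_p^\times \simeq p^{\mathbb{Q}}\times\mu_{ur}\times U_0$, where $\mu_{ur}$ is the group of roots of unity of order prime to $p$ and $U_0=\{z:|z-1|<1\}$; for $a\in\mathbb{C}_p^\times$ let $\langle a\rangle$ be its component in $U_0$, and define $\log_p a=\sum_{n\ge1}\frac{(-1)^{n-1}}{n}(\langle a\rangle-1)^n$ (so $\log_p p=0$). Write $\log_p^k a=(\log_p a)^k$. For a Laurent polynomial $f\in\mathbb{C}_p[t_1^{\pm1},\dots,t_n^{\pm1}]$ with no zero $(z_1,\dots,z_n)$ with all $|z_i|=1$, the $p$-adic $k$-higher Mahler measure is $m_{p,k}(f)=\lim_{N\to\infty,\,(N,p)=1} N^{-n}\sum_{\zeta\in\mu_N^n}\log_p^k f(\zeta)$, where $\mu_N$ is the set of $N$-th roots of unity in $\mathbb{C}_p$ (this limit exists). For an index $(k_1,\dots,k_r)\in\mathbb{Z}_{>0}^r$,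 $\operatorname{Li}_{(k_1,\dots,k_r)}(t)=\sum_{0<m_1<\dots<m_r} t^{m_r}/(m_1^{k_1}\cdots m_r^{k_r})$, which converges $p$-adically for $|t|<1$. Indices are identified with words in the noncommutative polynomial algebra $\mathbb{Q}\langle e_0,e_1\rangle$ via $(k_1,\dots,k_r)\mapsto e_{k_1}\cdots e_{k_r}$, $e_k:=e_1e_0^{k-1}$; $\mathfrak{H}^1=\mathbb{Q}+e_1\mathbb{Q}\langle e_0,e_1\rangle$. The harmonic product $\ast$ on $\mathfrak{H}^1$ is the $\mathbb{Q}$-bilinear product determined by $w\ast1=1\ast w=w$ and $e_kv\ast e_lw=e_k(v\ast e_lw)+e_l(e_kv\ast w)+e_{k+l}(v\ast w)$ for $k,l\ge1$, $v,w\in\mathfrak{H}^1$. $\{1\}^m$ denotes the index $(1,\dots,1)$ of length $m$ (the word $e_1^m$; $\{1\}^0$ is the empty word $1$). For $w=\sum_u c_u u\in\mathfrak{H}^1$ (a $\mathbb{Q}$-combination of words $u$), $\operatorname{Li}_{(w,2)}:=\sum_u c_u\operatorname{Li}_{(u,2)}$, where $(u,2)$ is the index $u$ with $2$ appended (the word $ue_2$). *)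

theory Defs
  imports
    "HOL-Analysis.Analysis"
    "HOL-Computational_Algebra.Polynomial"
    "HOL-Computational_Algebra.Primes"
    "HOL-Library.Poly_Mapping"
begin

text \<open>
  The absolute value is a class parameter of its own because \<open>norm\<close> is reserved for real normed
  vector spaces, which $p$-adic fields are not. All topological notions (limits, infinite sums,
  closures) are those of the induced metric.
\<close>

class nonarch_complete_field = field_char_0 + complete_space +
  fixes absval :: "'a \<Rightarrow> real"
  assumes dist_absval: "dist x y = absval (x - y)"
    and absval_mult: "absval (x * y) = absval x * absval y"
    and absval_ultrametric: "absval (x + y) \<le> max (absval x) (absval y)"

definition algebraic_over :: "'a::field set \<Rightarrow> 'a \<Rightarrow> bool" where
  "algebraic_over F x \<longleftrightarrow> (\<exists>f. f \<noteq> 0 \<and> (\<forall>i. poly.coeff f i \<in> F) \<and> poly f x = 0)"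

definition alg_closed_subset :: "'a::field set \<Rightarrow> bool" where
  "alg_closed_subset L \<longleftrightarrow>
    (\<forall>f. (\<forall>i. poly.coeff f i \<in> L) \<and> 0 < degree f \<longrightarrow> (\<exists>x\<in>L. poly f x = 0))"

text \<open>
  Since the ambient field is complete, the closure of \<open>\<rat>\<close> in it is the completion of \<open>\<rat>\<close>
  for the restricted absolute value, which is the $p$-adic one as soon as it is
  non-archimedean with $|p| = p^{-1}$. The field is then a completion of an algebraic closure of
  $\mathbf{Q}_p$ iff the elements algebraic over $\mathbf{Q}_p$ form an algebraically closed,
  dense subfield.
\<close>

definition Qp :: "'a::nonarch_complete_field set" where
  "Qp = closure \<rat>"

definition Qp_bar :: "'a::nonarch_complete_field set" where
  "Qp_bar = {x. algebraic_over Qp x}"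

definition is_Cp :: "nat \<Rightarrow> 'a::nonarch_complete_field itself \<Rightarrow> bool" where
  "is_Cp p (_ :: 'a itself) \<longleftrightarrow>
     absval (of_nat p :: 'a) = 1 / real p \<and>
     alg_closed_subset (Qp_bar :: 'a set) \<and>
     closure (Qp_bar :: 'a set) = UNIV"

text \<open>
  The subgroup \<open>p\<^sup>\<rat>\<close> of \<open>\<complex>\<^sub>p\<^sup>\<times>\<close> depends on a choice of a
  compatible system of roots of $p$, i.e. a homomorphism \<open>r \<mapsto> p\<^sup>r\<close> from
  the rationals to the multiplicative group with \<open>p\<^sup>1 = p\<close>.
\<close>

definition is_p_power :: "nat \<Rightarrow> (rat \<Rightarrow> 'a::nonarch_complete_field) \<Rightarrow> bool" where
  "is_p_power p pw \<longleftrightarrow> (\<forall>r s. pw (r + s) = pw r * pw s) \<and> pw 1 = of_nat p"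

definition mu_ur :: "nat \<Rightarrow> 'a::nonarch_complete_field set" where
  "mu_ur p = {z. \<exists>n>0. coprime n p \<and> z ^ n = 1}"

definition U0 :: "'a::nonarch_complete_field set" where
  "U0 = {z. absval (z - 1) < 1}"

definition U0_part :: "nat \<Rightarrow> (rat \<Rightarrow> 'a) \<Rightarrow> 'a \<Rightarrow> 'a::nonarch_complete_field" where
  "U0_part p pw a = (THE u. u \<in> U0 \<and> (\<exists>r. \<exists>\<omega>\<in>mu_ur p. a = pw r * \<omega> * u))"

definition log_p :: "nat \<Rightarrow> (rat \<Rightarrow> 'a) \<Rightarrow> 'a \<Rightarrow> 'a::nonarch_complete_field" where
  "log_p p pw a = suminf (\<lambda>n. (-1) ^ n / of_nat (Suc n) * (U0_part p pw a - 1) ^ Suc n)"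

text \<open>
  Laurent polynomials in variables indexed by a finite type \<open>'n\<close>: finitely supported
  coefficient functions on integer exponent vectors, with the convolution product of
  \<open>Poly_Mapping\<close>.
\<close>

type_synonym ('n, 'a) laurent = "('n \<Rightarrow>\<^sub>0 int) \<Rightarrow>\<^sub>0 'a"

definition laurent_const :: "'a::comm_ring_1 \<Rightarrow> ('n, 'a) laurent" where
  "laurent_const c = Poly_Mapping.single 0 c"

definition laurent_var :: "'n \<Rightarrow> ('n, 'a::comm_ring_1) laurent" where
  "laurent_var i = Poly_Mapping.single (Poly_Mapping.single i 1) 1"

definition laurent_eval :: "('n::finite, 'a::field) laurent \<Rightarrow> ('n \<Rightarrow> 'a) \<Rightarrow> 'a" where
  "laurent_eval f z =
     (\<Sum>e\<in>Poly_Mapping.keys f. Poly_Mapping.lookup f e *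
        (\<Prod>i\<in>UNIV. z i powi Poly_Mapping.lookup e i))"

definition mu :: "nat \<Rightarrow> 'a::field set" where
  "mu N = {z. z ^ N = 1}"

text \<open>
  Only meaningful for \<open>f\<close> without zeros in the locus where all coordinates have absolute value 1.
\<close>

definition mahler_measure_p ::
    "nat \<Rightarrow> (rat \<Rightarrow> 'a::nonarch_complete_field) \<Rightarrow> nat \<Rightarrow> ('n::finite, 'a) laurent \<Rightarrow> 'a" where
  "mahler_measure_p p pw k f =
     Lim (inf sequentially (principal {N. coprime N p}))
       (\<lambda>N. (\<Sum>\<zeta> | \<forall>i. \<zeta> i \<in> mu N. log_p p pw (laurent_eval f \<zeta>) ^ k) /
              of_nat N ^ CARD('n))"

text \<open>
  The index $(k_1,\dots,k_r)$, equivalently the word $e_{k_1}\cdots e_{k_r}$, is the list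
  \<open>[k\<^sub>1, \<dots>, k\<^sub>r]\<close> of positive integers. These words are a basis of $\mathfrak{H}^1$, whose
  elements are thus finitely supported rational-valued functions on lists.
\<close>

type_synonym index = "nat list"
type_synonym H1 = "index \<Rightarrow>\<^sub>0 rat"

definition Li :: "index \<Rightarrow> 'a \<Rightarrow> 'a::nonarch_complete_field" where
  "Li ks t =
     (\<Sum>\<^sub>\<infinity>ms\<in>{ms :: nat list. length ms = length ks \<and> sorted_wrt (<) ms \<and> (\<forall>m\<in>set ms. 0 < m)}.
        t ^ last ms / (\<Prod>i<length ks. of_nat (ms ! i) ^ (ks ! i)))"

definition word :: "index \<Rightarrow> H1" where
  "word u = Poly_Mapping.single u 1"

definition lmult_e :: "nat \<Rightarrow> H1 \<Rightarrow> H1" where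
  "lmult_e k w = (\<Sum>u\<in>Poly_Mapping.keys w. Poly_Mapping.single (k # u) (Poly_Mapping.lookup w u))"

fun harmonic_word :: "index \<Rightarrow> index \<Rightarrow> H1" where
  "harmonic_word [] w = word w"
| "harmonic_word v [] = word v"
| "harmonic_word (k # v) (l # w) =
     lmult_e k (harmonic_word v (l # w)) +
     lmult_e l (harmonic_word (k # v) w) +
     lmult_e (k + l) (harmonic_word v w)"

definition harmonic :: "H1 \<Rightarrow> H1 \<Rightarrow> H1" (infixl \<open>\<^bold>*\<close> 70) where
  "v \<^bold>* w =
     (\<Sum>a\<in>Poly_Mapping.keys v. \<Sum>b\<in>Poly_Mapping.keys w.
        Poly_Mapping.map (\<lambda>c. Poly_Mapping.lookup v a * Poly_Mapping.lookup w b * c)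
          (harmonic_word a b))"

definition Li_append2 :: "H1 \<Rightarrow> 'a \<Rightarrow> 'a::nonarch_complete_field" where
  "Li_append2 w t =
     (\<Sum>u\<in>Poly_Mapping.keys w. of_rat (Poly_Mapping.lookup w u) * Li (u @ [2]) t)"

end

theory Submission
  imports Defs
begin

text \<open>
  For a root of unity $\zeta$ of order prime to $p$ one has
  $\log_p((\zeta-\alpha)(\zeta-\beta)) = \log_p\alpha + \log(1-\zeta/\alpha) + \log(1-\beta/\zeta)$,
  and the last two terms are power series in $\zeta$ and $\zeta^{-1}$ that converge uniformly on the
  unit circle. By orthogonality of roots of unity the mean over $\mu_N$ of
  $\log^i(1-\zeta/\alpha)\log^j(1-\beta/\zeta)$ tends to the constant term of the product of the
  two series. Since $(-\log(1-X))^i/i!$ has $n$-th coefficient $n^{-1}$ times the truncated harmonic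
  sum of index $\{1\}^{i-1}$ below $n$, and truncated sums multiply by the harmonic product, this
  constant term is
  $(-1)^{i+j}i!\,j!\operatorname{Li}_{(\{1\}^{i-1}\ast\{1\}^{j-1},2)}(\beta/\alpha)$; the trinomial
  expansion gives the formula.

  Additivity of the logarithm on principal units comes from $\log u = \lim_n (u^{p^n}-1)/p^n$. That
  $\log_p$ is defined on all of $\mathbf{C}_p^\times$ rests on the density of the algebraic
  elements: by the ultrametric inequality two terms of a vanishing sum $\sum_i f_i b^i$ share the
  largest absolute value, so $|b|\in p^{\mathbf{Q}}$, and modulo the maximal ideal the powers of a
  unit $b$ take finitely many values, so $b^n$ is a principal unit for some $n>0$.
\<close>

section \<open>Non-archimedean absolute values\<close>

lemma absval_nonneg [simp]: "0 \<le> absval x"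
  using zero_le_dist[of x 0] by (simp add: dist_absval)

lemma absval_eq_0_iff [simp]: "absval x = 0 \<longleftrightarrow> x = 0"
  using dist_eq_0_iff[of x 0] by (simp add: dist_absval)

lemma absval_0 [simp]: "absval (0 :: 'a::nonarch_complete_field) = 0"
  by simp

lemma absval_pos_iff [simp]: "0 < absval x \<longleftrightarrow> x \<noteq> 0"
  by (metis absval_eq_0_iff absval_nonneg less_le)

lemma absval_1 [simp]: "absval (1 :: 'a::nonarch_complete_field) = 1"
  using absval_mult[of "1 :: 'a" 1] by simp

lemma absval_minus [simp]: "absval (- x) = absval x"
  using dist_commute[of x 0] by (simp add: dist_absval)

lemma absval_minus_commute: "absval (x - y) = absval (y - x)"
  using dist_commute[of x y] by (simp add: dist_absval)

lemma absval_power: "absval (x ^ n) = absval x ^ n"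
  by (induction n) (simp_all add: absval_mult)

lemma absval_inverse: "absval (inverse x) = inverse (absval x)"
proof (cases "x = 0")
  case False
  hence "absval x * absval (inverse x) = 1"
    by (simp flip: absval_mult)
  thus ?thesis
    by (rule inverse_unique[symmetric])
qed simp

lemma absval_divide: "absval (x / y) = absval x / absval y"
  by (simp add: divide_inverse absval_mult absval_inverse)

lemma absval_power_int: "absval (x powi n) = absval x powi n"
  by (simp add: power_int_def absval_power absval_inverse)

lemma absval_prod: "absval (prod f A) = (\<Prod>x\<in>A. absval (f x))"
  by (induction A rule: infinite_finite_induct) (simp_all add: absval_mult)

lemma absval_add_le: "absval x \<le> c \<Longrightarrow> absval y \<le> c \<Longrightarrow> absval (x + y) \<le> c"
  using absval_ultrametric[of x y] by linarith

lemma absval_add_less: "absval x < c \<Longrightarrow> absval y < c \<Longrightarrow> absval (x + y) < c"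
  using absval_ultrametric[of x y] by linarith

lemma absval_triangle: "absval (x + y) \<le> absval x + absval y"
  by (rule absval_add_le) simp_all

lemma absval_sum_le:
  assumes "0 \<le> c" "\<And>x. x \<in> A \<Longrightarrow> absval (f x) \<le> c"
  shows "absval (sum f A) \<le> c"
  using assms by (induction A rule: infinite_finite_induct) (auto intro: absval_add_le)

lemma absval_sum_less:
  assumes "0 < c" "\<And>x. x \<in> A \<Longrightarrow> absval (f x) < c"
  shows "absval (sum f A) < c"
  using assms by (induction A rule: infinite_finite_induct) (auto intro: absval_add_less)

lemma absval_eq_if_close:
  assumes "absval (x - y) < absval x"
  shows "absval y = absval x"
proof (rule antisym)
  show "absval y \<le> absval x"
    using absval_add_le[of "y - x" "absval x" x] assms by (simp add: absval_minus_commute)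
  show "absval x \<le> absval y"
    using absval_ultrametric[of "x - y" y] assms by auto
qed

lemma absval_of_nat_le_1: "absval (of_nat n :: 'a::nonarch_complete_field) \<le> 1"
  by (induction n) (auto intro: absval_add_le)

lemma absval_of_int_le_1: "absval (of_int k :: 'a::nonarch_complete_field) \<le> 1"
  by (cases k rule: int_cases2) (simp_all add: absval_of_nat_le_1)

lemma sum_eq_0_imp_equal_absval:
  assumes "finite A" "sum g A = 0" "k \<in> A" "g k \<noteq> 0"
  obtains i j where "i \<in> A" "j \<in> A" "i \<noteq> j" "g i \<noteq> 0" "absval (g i) = absval (g j)"
proof -
  obtain i where i: "i \<in> A" "Max ((\<lambda>j. absval (g j)) ` A) = absval (g i)"
    using assms(1,3) by (metis empty_iff obtains_MAX)
  hence max: "absval (g j) \<le> absval (g i)" if "j \<in> A" for j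
    using that assms(1) by (metis Max_ge finite_imageI imageI)
  have "g i \<noteq> 0"
    using max[OF assms(3)] assms(4) by (metis absval_0 absval_pos_iff leD)
  moreover have "\<exists>j\<in>A - {i}. absval (g j) = absval (g i)"
  proof (rule ccontr)
    assume "\<not> ?thesis"
    hence "absval (sum g (A - {i})) < absval (g i)"
      using max \<open>g i \<noteq> 0\<close> by (intro absval_sum_less) (auto simp: less_le)
    moreover have "sum g (A - {i}) = - g i"
      using sum.remove[OF assms(1) i(1), of g] assms(2)
      by (simp add: eq_neg_iff_add_eq_0 add.commute)
    ultimately show False
      by simp
  qed
  ultimately show thesis
    using that i(1) by fastforce
qed

definition residue_eq :: "'a::nonarch_complete_field \<Rightarrow> 'a \<Rightarrow> bool" (infix \<open>\<equiv>\<^sub>\<mm>\<close> 50) where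
  "x \<equiv>\<^sub>\<mm> y \<longleftrightarrow> absval (x - y) < 1"

lemma residue_eq_refl [simp]: "x \<equiv>\<^sub>\<mm> x"
  by (simp add: residue_eq_def)

lemma residue_eq_sym: "x \<equiv>\<^sub>\<mm> y \<Longrightarrow> y \<equiv>\<^sub>\<mm> x"
  by (simp add: residue_eq_def absval_minus_commute)

lemma residue_eq_trans [trans]: "x \<equiv>\<^sub>\<mm> y \<Longrightarrow> y \<equiv>\<^sub>\<mm> z \<Longrightarrow> x \<equiv>\<^sub>\<mm> z"
  using absval_add_less[of "x - y" 1 "y - z"] by (simp add: residue_eq_def)

lemma residue_eq_0_iff: "x \<equiv>\<^sub>\<mm> 0 \<longleftrightarrow> absval x < 1"
  by (simp add: residue_eq_def)

lemma residue_eq_iff_diff: "x \<equiv>\<^sub>\<mm> y \<longleftrightarrow> x - y \<equiv>\<^sub>\<mm> 0"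
  by (simp add: residue_eq_def)

lemma residue_eq_add: "x \<equiv>\<^sub>\<mm> x' \<Longrightarrow> y \<equiv>\<^sub>\<mm> y' \<Longrightarrow> x + y \<equiv>\<^sub>\<mm> x' + y'"
  using absval_add_less[of "x - x'" 1 "y - y'"] by (simp add: residue_eq_def algebra_simps)

lemma residue_eq_sum: "(\<And>i. i \<in> A \<Longrightarrow> f i \<equiv>\<^sub>\<mm> g i) \<Longrightarrow> sum f A \<equiv>\<^sub>\<mm> sum g A"
  using absval_sum_less[of 1 A "\<lambda>i. f i - g i"] by (simp add: residue_eq_def sum_subtractf)

lemma residue_eq_scale:
  assumes "x \<equiv>\<^sub>\<mm> y" "absval c \<le> 1"
  shows "c * x \<equiv>\<^sub>\<mm> c * y"
proof -
  have "absval c * absval (x - y) < 1"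
    using mult_right_mono[OF assms(2), of "absval (x - y)"] assms(1) by (simp add: residue_eq_def)
  thus ?thesis
    by (simp add: residue_eq_def right_diff_distrib flip: absval_mult)
qed

lemma residue_eq_mult:
  assumes "x \<equiv>\<^sub>\<mm> x'" "y \<equiv>\<^sub>\<mm> y'" "absval x \<le> 1" "absval y' \<le> 1"
  shows "x * y \<equiv>\<^sub>\<mm> x' * y'"
proof -
  have "x * y \<equiv>\<^sub>\<mm> x * y'"
    using assms(2,3) by (rule residue_eq_scale)
  also have "x * y' \<equiv>\<^sub>\<mm> x' * y'"
    using residue_eq_scale[OF assms(1,4)] by (simp add: mult.commute)
  finally show ?thesis .
qed

lemma residue_eq_power:
  assumes "x \<equiv>\<^sub>\<mm> y" "absval x \<le> 1" "absval y \<le> 1"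
  shows "x ^ n \<equiv>\<^sub>\<mm> y ^ n"
  using assms by (induction n) (auto intro!: residue_eq_mult simp: absval_power power_le_one)

lemma absval_eq_1_residue_cong:
  assumes "x \<equiv>\<^sub>\<mm> y"
  shows "absval x = 1 \<longleftrightarrow> absval y = 1"
  using absval_eq_if_close[of x y] absval_eq_if_close[of y x] assms
  by (auto simp: residue_eq_def absval_minus_commute)

lemma tendsto_absval_iff:
  fixes l :: "'a::nonarch_complete_field"
  shows "(f \<longlongrightarrow> l) F \<longleftrightarrow> ((\<lambda>x. absval (f x - l)) \<longlongrightarrow> 0) F"
  by (subst tendsto_dist_iff) (simp add: dist_absval)

lemma tendsto_absval_le:
  fixes l :: "'a::nonarch_complete_field"
  assumes "(g \<longlongrightarrow> 0) F" "\<And>x. absval (f x - l) \<le> g x"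
  shows "(f \<longlongrightarrow> l) F"
  unfolding tendsto_absval_iff
  by (rule tendsto_sandwich[OF _ _ tendsto_const assms(1)]) (simp_all add: assms(2))

lemma tendsto_0_absval_iff:
  "(f \<longlongrightarrow> (0 :: 'a::nonarch_complete_field)) F \<longleftrightarrow> ((\<lambda>x. absval (f x)) \<longlongrightarrow> 0) F"
  by (subst tendsto_absval_iff) simp

lemma tendsto_0_absval_le:
  assumes "(g \<longlongrightarrow> 0) F" "\<And>x. absval (f x) \<le> g x"
  shows "(f \<longlongrightarrow> (0 :: 'a::nonarch_complete_field)) F"
  using assms by (intro tendsto_absval_le[of g]) simp_all

instance nonarch_complete_field \<subseteq> topological_ab_group_add
proof
  fix a b :: 'a
  have fst: "((\<lambda>x. absval (fst x - a)) \<longlongrightarrow> 0) (nhds a \<times>\<^sub>F nhds b)"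
    and snd: "((\<lambda>x. absval (snd x - b)) \<longlongrightarrow> 0) (nhds a \<times>\<^sub>F nhds b)"
    by (simp_all add: filterlim_fst filterlim_snd flip: tendsto_absval_iff)
  show "((\<lambda>x. fst x + snd x) \<longlongrightarrow> a + b) (nhds a \<times>\<^sub>F nhds b)"
  proof (rule tendsto_absval_le[OF tendsto_add_zero[OF fst snd]])
    show "absval (fst x + snd x - (a + b)) \<le> absval (fst x - a) + absval (snd x - b)" for x
      using absval_triangle[of "fst x - a" "snd x - b"] by (simp add: algebra_simps)
  qed
  have "((\<lambda>x. absval (x - a)) \<longlongrightarrow> 0) (nhds a)"
    by (simp add: filterlim_ident flip: tendsto_absval_iff)
  thus "(uminus \<longlongrightarrow> - a) (nhds a)"
    by (rule tendsto_absval_le) (simp add: absval_minus_commute)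
qed

instance nonarch_complete_field \<subseteq> topological_comm_monoid_mult
proof
  fix a b :: 'a
  let ?dx = "\<lambda>x. absval (fst x - a)" and ?dy = "\<lambda>x. absval (snd x - b)"
  have dx: "(?dx \<longlongrightarrow> 0) (nhds a \<times>\<^sub>F nhds b)" and dy: "(?dy \<longlongrightarrow> 0) (nhds a \<times>\<^sub>F nhds b)"
    by (simp_all add: filterlim_fst filterlim_snd flip: tendsto_absval_iff)
  have "((\<lambda>x. ?dx x * ?dy x + (?dx x * absval b + absval a * ?dy x)) \<longlongrightarrow> 0) (nhds a \<times>\<^sub>F nhds b)"
    by (intro dx dy tendsto_add_zero tendsto_mult_zero tendsto_mult_left_zero
        tendsto_mult_right_zero)
  thus "((\<lambda>x. fst x * snd x) \<longlongrightarrow> a * b) (nhds a \<times>\<^sub>F nhds b)"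
  proof (rule tendsto_absval_le)
    fix x :: "'a \<times> 'a"
    have "fst x * snd x - a * b =
        (fst x - a) * (snd x - b) + ((fst x - a) * b + a * (snd x - b))"
      by (simp add: algebra_simps)
    also have "absval \<dots> \<le> absval ((fst x - a) * (snd x - b)) +
        (absval ((fst x - a) * b) + absval (a * (snd x - b)))"
      by (intro order_trans[OF absval_triangle] add_left_mono absval_triangle)
    finally show "absval (fst x * snd x - a * b) \<le>
        ?dx x * ?dy x + (?dx x * absval b + absval a * ?dy x)"
      by (simp add: absval_mult)
  qed
qed

lemma absval_le_limit:
  fixes f :: "nat \<Rightarrow> 'a::nonarch_complete_field"
  assumes "f \<longlonglongrightarrow> l" "eventually (\<lambda>n. absval (f n) \<le> c) sequentially"
  shows "absval l \<le> c"
proof -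
  have "(\<lambda>n. dist (f n) 0) \<longlonglongrightarrow> dist l 0"
    by (intro tendsto_intros assms)
  hence "(\<lambda>n. absval (f n)) \<longlonglongrightarrow> absval l"
    by (simp add: dist_absval)
  from tendsto_upperbound[OF this assms(2)] show ?thesis
    by simp
qed

lemma tendsto_gbinomial:
  fixes c :: "'a::nonarch_complete_field"
  assumes "(f \<longlongrightarrow> c) F"
  shows "((\<lambda>x. f x gchoose m) \<longlongrightarrow> c gchoose m) F"
proof -
  have "((\<lambda>x. (\<Prod>i=0..<m. f x - of_nat i) * (1 / fact m)) \<longlongrightarrow>
      (\<Prod>i=0..<m. c - of_nat i) * (1 / fact m)) F"
    by (intro tendsto_mult tendsto_prod' tendsto_diff tendsto_const assms)
  thus ?thesis
    by (simp add: gbinomial_prod_rev)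
qed

section \<open>Convergence of series\<close>

lemma summable_iff_tendsto_0:
  fixes f :: "nat \<Rightarrow> 'a::nonarch_complete_field"
  shows "summable f \<longleftrightarrow> f \<longlonglongrightarrow> 0"
proof
  assume "summable f"
  then obtain s where s: "(\<lambda>n. sum f {..<n}) \<longlonglongrightarrow> s"
    by (auto simp: summable_def sums_def)
  have "(\<lambda>n. sum f {..<Suc n} - sum f {..<n}) \<longlonglongrightarrow> s - s"
    by (intro tendsto_diff LIMSEQ_Suc s)
  thus "f \<longlonglongrightarrow> 0"
    by simp
next
  assume "f \<longlonglongrightarrow> 0"
  have "Cauchy (\<lambda>n. sum f {..<n})"
  proof (rule metric_CauchyI)
    fix e :: real assume "0 < e"
    then obtain M where M: "absval (f m) < e" if "m \<ge> M" for m
      using \<open>f \<longlonglongrightarrow> 0\<close> by (auto simp: lim_sequentially dist_absval)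
    have "dist (sum f {..<m}) (sum f {..<n}) < e" if "M \<le> m" "m \<le> n" for m n
    proof -
      have "absval (sum f {m..<n}) < e"
        using that M \<open>0 < e\<close> by (intro absval_sum_less) auto
      also have "sum f {m..<n} = sum f {..<n} - sum f {..<m}"
        using that by (simp add: sum_diff_nat_ivl flip: atLeast0LessThan)
      finally show ?thesis
        by (simp add: dist_absval absval_minus_commute)
    qed
    thus "\<exists>M. \<forall>m\<ge>M. \<forall>n\<ge>M. dist (sum f {..<m}) (sum f {..<n}) < e"
      by (metis dist_commute nle_le)
  qed
  thus "summable f"
    by (simp add: summable_iff_convergent Cauchy_convergent_iff)
qed

lemmas sums_imp_tendsto_0 = sums_summable[THEN summable_iff_tendsto_0[THEN iffD1]]

lemma tendsto_0_imp_absval_bounded: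
  fixes f :: "nat \<Rightarrow> 'a::nonarch_complete_field"
  assumes "f \<longlonglongrightarrow> 0"
  obtains K where "0 < K" "\<And>n. absval (f n) \<le> K"
proof -
  have "Bseq (\<lambda>n. absval (f n))"
    using assms unfolding tendsto_0_absval_iff by (auto intro: convergent_imp_Bseq convergentI)
  thus thesis
    using that by (auto elim!: BseqE)
qed

lemma absval_sums_minus_partial_le:
  fixes f :: "nat \<Rightarrow> 'a::nonarch_complete_field"
  assumes "f sums s" "\<And>n. n \<ge> M \<Longrightarrow> absval (f n) \<le> c"
  shows "absval (s - sum f {..<M}) \<le> c"
proof (rule absval_le_limit)
  show "(\<lambda>n. sum f {..<n} - sum f {..<M}) \<longlonglongrightarrow> s - sum f {..<M}"
    using assms(1) unfolding sums_def by (intro tendsto_intros)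
  have "0 \<le> c"
    using assms(2)[of M] by (meson absval_nonneg order_refl order_trans)
  have "absval (sum f {..<n} - sum f {..<M}) \<le> c" if "n \<ge> M" for n
  proof -
    have "sum f {..<n} - sum f {..<M} = sum f {M..<n}"
      using that by (simp add: sum_diff_nat_ivl flip: atLeast0LessThan)
    also have "absval \<dots> \<le> c"
      using assms(2) \<open>0 \<le> c\<close> by (intro absval_sum_le) auto
    finally show ?thesis .
  qed
  thus "eventually (\<lambda>n. absval (sum f {..<n} - sum f {..<M}) \<le> c) sequentially"
    by (auto simp: eventually_sequentially)
qed

lemma absval_sums_le:
  fixes f :: "nat \<Rightarrow> 'a::nonarch_complete_field"
  assumes "f sums s" "\<And>n. absval (f n) \<le> c"
  shows "absval s \<le> c"
  using absval_sums_minus_partial_le[OF assms(1), of 0 c] assms(2) by simp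

lemma sums_mult_nonarch:
  fixes f :: "nat \<Rightarrow> 'a::nonarch_complete_field"
  assumes "f sums s"
  shows "(\<lambda>n. c * f n) sums (c * s)"
  using tendsto_mult[OF tendsto_const[of c] assms[unfolded sums_def]]
  by (simp add: sums_def sum_distrib_left)

lemma tannerys_theorem_nonarch:
  fixes f :: "'i \<Rightarrow> nat \<Rightarrow> 'a::nonarch_complete_field"
  assumes lim: "\<And>m. ((\<lambda>k. f k m) \<longlongrightarrow> g m) F"
    and bound: "eventually (\<lambda>k. \<forall>m. absval (f k m) \<le> b m) F" and vanishing: "b \<longlonglongrightarrow> 0"
    and sums: "eventually (\<lambda>k. f k sums s k) F" "g sums t"
  shows "(s \<longlongrightarrow> t) F"
proof (rule tendstoI)
  fix e :: real assume e: "0 < e"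
  have "eventually (\<lambda>M. \<forall>m\<ge>M. b m < e / 2) sequentially"
    using order_tendstoD(2)[OF vanishing, of "e / 2"] e by (simp add: eventually_all_ge_at_top)
  moreover have "eventually (\<lambda>M. dist (\<Sum>m<M. g m) t < e) sequentially"
    using sums(2) e unfolding sums_def by (rule tendstoD)
  ultimately obtain M where M: "\<And>m. m \<ge> M \<Longrightarrow> b m < e / 2" "dist (\<Sum>m<M. g m) t < e"
    using eventually_happens'[OF sequentially_bot eventually_conj] by blast
  have "((\<lambda>k. \<Sum>m<M. f k m) \<longlongrightarrow> (\<Sum>m<M. g m)) F"
    by (intro tendsto_sum lim)
  hence "eventually (\<lambda>k. dist (\<Sum>m<M. f k m) (\<Sum>m<M. g m) < e) F"
    using e by (rule tendstoD)
  with bound sums(1) show "eventually (\<lambda>k. dist (s k) t < e) F"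
  proof eventually_elim
    case (elim k)
    have "absval (s k - (\<Sum>m<M. f k m)) \<le> e / 2"
      using elim(1) M(1)
      by (intro absval_sums_minus_partial_le elim(2)) (meson less_imp_le order_trans)
    hence "absval ((s k - (\<Sum>m<M. f k m)) +
        (((\<Sum>m<M. f k m) - (\<Sum>m<M. g m)) + ((\<Sum>m<M. g m) - t))) < e"
      using elim(3) M(2) e by (intro absval_add_less) (simp_all add: dist_absval)
    thus ?case
      by (simp add: dist_absval)
  qed
qed

lemma sum_Cauchy_product_eq_partial_sums:
  fixes a b :: "nat \<Rightarrow> 'a::comm_semiring_0"
  shows "(\<Sum>n<M. \<Sum>i\<le>n. a i * b (n - i)) = (\<Sum>i<M. a i * (\<Sum>j<M - i. b j))"
proof -
  have "(\<Sum>i<M. a i * (\<Sum>j<M - i. b j)) = (\<Sum>(i, j)\<in>Sigma {..<M} (\<lambda>i. {..<M - i}). a i * b j)"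
    by (simp add: sum_distrib_left sum.Sigma)
  also have "Sigma {..<M} (\<lambda>i. {..<M - i}) = {(i, j). i + j < M}"
    by auto
  finally show ?thesis
    by (simp add: sum.triangle_reindex)
qed

lemma sums_Cauchy_product_nonarch:
  fixes a b :: "nat \<Rightarrow> 'a::nonarch_complete_field"
  assumes a: "a sums A" and b: "b sums B"
  shows "(\<lambda>n. \<Sum>i\<le>n. a i * b (n - i)) sums (A * B)"
proof -
  obtain K where K: "0 < K" "\<And>n. absval (b n) \<le> K"
    using tendsto_0_imp_absval_bounded[OF sums_imp_tendsto_0[OF b]] by blast
  let ?f = "\<lambda>M i. if i \<in> {..<M} then a i * (\<Sum>j<M - i. b j) else 0"
  have "(\<lambda>M. \<Sum>i<M. a i * (\<Sum>j<M - i. b j)) \<longlonglongrightarrow> A * B"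
  proof (rule tannerys_theorem_nonarch[where f = ?f])
    show "(\<lambda>M. ?f M i) \<longlonglongrightarrow> a i * B" for i
    proof (rule Lim_transform_eventually)
      show "(\<lambda>M. a i * (\<Sum>j<M - i. b j)) \<longlonglongrightarrow> a i * B"
        using b[unfolded sums_def] filterlim_minus_const_nat_at_top[of i]
        by (intro tendsto_mult tendsto_const) (rule filterlim_compose)
      show "\<forall>\<^sub>F M in sequentially. a i * (\<Sum>j<M - i. b j) = ?f M i"
        using eventually_gt_at_top[of i] by eventually_elim simp
    qed
    have "absval (?f M i) \<le> absval (a i) * K" for M i
      using K by (auto simp: absval_mult intro!: mult_left_mono absval_sum_le)
    thus "\<forall>\<^sub>F M in sequentially. \<forall>i. absval (?f M i) \<le> absval (a i) * K"
      by simp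
    show "(\<lambda>i. absval (a i) * K) \<longlonglongrightarrow> 0"
      using sums_imp_tendsto_0[OF a]
      by (intro tendsto_mult_left_zero) (simp add: tendsto_0_absval_iff)
    show "\<forall>\<^sub>F M in sequentially. ?f M sums (\<Sum>i<M. a i * (\<Sum>j<M - i. b j))"
      by (intro always_eventually allI sums_If_finite_set) simp
    show "(\<lambda>i. a i * B) sums (A * B)"
      using sums_mult_nonarch[OF a, of B] by (simp add: mult.commute)
  qed
  thus ?thesis
    by (simp add: sums_def sum_Cauchy_product_eq_partial_sums)
qed

lemma fps_mult_sums:
  fixes f g :: "'a::nonarch_complete_field fps"
  assumes "(\<lambda>n. fps_nth f n * x ^ n) sums A" "(\<lambda>n. fps_nth g n * x ^ n) sums B"
  shows "(\<lambda>n. fps_nth (f * g) n * x ^ n) sums (A * B)"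
proof -
  have "(\<Sum>i\<le>n. (fps_nth f i * x ^ i) * (fps_nth g (n - i) * x ^ (n - i))) =
      fps_nth (f * g) n * x ^ n" for n
  proof -
    have "x ^ i * x ^ (n - i) = x ^ n" if "i \<le> n" for i
      using that by (simp flip: power_add)
    thus ?thesis
      by (auto simp: fps_mult_nth sum_distrib_right atMost_atLeast0 intro!: sum.cong)
  qed
  with sums_Cauchy_product_nonarch[OF assms] show ?thesis
    by simp
qed

lemma fps_power_sums:
  fixes f :: "'a::nonarch_complete_field fps"
  assumes "(\<lambda>n. fps_nth f n * x ^ n) sums A"
  shows "(\<lambda>n. fps_nth (f ^ i) n * x ^ n) sums (A ^ i)"
proof (induction i)
  case 0
  have "(\<lambda>n. fps_nth 1 n * x ^ n) sums (\<Sum>n\<in>{0}. fps_nth 1 n * x ^ n)"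
    by (rule sums_finite) auto
  thus ?case
    by simp
next
  case (Suc i)
  show ?case
    using fps_mult_sums[OF assms Suc] by simp
qed

lemma has_sum_UN_nonarch:
  fixes f :: "'i \<Rightarrow> 'a::nonarch_complete_field"
  assumes finite: "\<And>n. finite (B n)" and disjoint: "disjoint_family B"
    and bound: "\<And>n i. i \<in> B n \<Longrightarrow> absval (f i) \<le> b n" and vanishing: "b \<longlonglongrightarrow> 0"
    and sums: "(\<lambda>n. sum f (B n)) sums l"
  shows "(f has_sum l) (\<Union>n. B n)"
  unfolding has_sum_def
proof (rule tendstoI)
  fix e :: real assume e: "0 < e"
  define S where "S M = (\<Union>n<M. B n)" for M
  have sum_S: "sum f (S M) = (\<Sum>n<M. sum f (B n))" for M
    unfolding S_def using disjoint finite
    by (intro sum.UNION_disjoint) (auto simp: disjoint_family_on_def)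
  have "eventually (\<lambda>M. \<forall>n\<ge>M. b n < e) sequentially"
    using order_tendstoD(2)[OF vanishing e] by (simp add: eventually_all_ge_at_top)
  moreover have "eventually (\<lambda>M. dist (sum f (S M)) l < e) sequentially"
    using sums e unfolding sums_def sum_S by (rule tendstoD)
  ultimately obtain M where M: "\<And>n. n \<ge> M \<Longrightarrow> b n < e" "dist (sum f (S M)) l < e"
    using eventually_happens'[OF sequentially_bot eventually_conj] by blast
  have "dist (sum f A) l < e" if A: "finite A" "S M \<subseteq> A" "A \<subseteq> (\<Union>n. B n)" for A
  proof -
    have "absval (sum f (A - S M)) < e"
    proof (rule absval_sum_less[OF e])
      fix i assume "i \<in> A - S M"
      then obtain n where "i \<in> B n" "n \<ge> M"
        using A(3) by (auto simp: S_def not_less[symmetric])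
      thus "absval (f i) < e"
        using bound[of i n] M(1)[of n] by simp
    qed
    hence "absval (sum f (A - S M) + (sum f (S M) - l)) < e"
      using M(2) by (intro absval_add_less) (simp_all add: dist_absval)
    thus ?thesis
      using sum.subset_diff[OF A(2,1), of f] by (simp add: dist_absval add_diff_eq)
  qed
  moreover have "finite (S M)" "S M \<subseteq> (\<Union>n. B n)"
    using finite by (auto simp: S_def)
  ultimately show "eventually (\<lambda>A. dist (sum f A) l < e) (finite_subsets_at_top (\<Union>n. B n))"
    unfolding eventually_finite_subsets_at_top by blast
qed

lemma sums_infsum_nonarch:
  fixes f :: "'i \<Rightarrow> 'a::nonarch_complete_field"
  assumes "\<And>n. finite (B n)" "disjoint_family B"
    and bound: "\<And>n i. i \<in> B n \<Longrightarrow> absval (f i) \<le> b n" and vanishing: "b \<longlonglongrightarrow> 0"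
  shows "(\<lambda>n. sum f (B n)) sums infsum f (\<Union>n. B n)"
proof -
  have "(\<lambda>n. sum f (B n)) \<longlonglongrightarrow> 0"
  proof (rule tendsto_0_absval_le)
    show "(\<lambda>n. \<bar>b n\<bar>) \<longlonglongrightarrow> 0"
      using vanishing by (rule tendsto_rabs_zero)
    show "absval (sum f (B n)) \<le> \<bar>b n\<bar>" for n
      by (intro absval_sum_le) (auto intro: order_trans[OF bound])
  qed
  then obtain l where l: "(\<lambda>n. sum f (B n)) sums l"
    by (auto simp: summable_def simp flip: summable_iff_tendsto_0)
  from has_sum_UN_nonarch[OF assms l] have "infsum f (\<Union>n. B n) = l"
    by (rule infsumI)
  with l show ?thesis
    by simp
qed

section \<open>Roots of unity\<close>

definition primitive_root_of_unity :: "nat \<Rightarrow> 'a::field \<Rightarrow> bool" where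
  "primitive_root_of_unity N \<zeta> \<longleftrightarrow> (\<forall>k. \<zeta> ^ k = 1 \<longleftrightarrow> N dvd k)"

lemma power_eq_1_iff_primitive: "primitive_root_of_unity N \<zeta> \<Longrightarrow> \<zeta> ^ k = 1 \<longleftrightarrow> N dvd k"
  by (simp add: primitive_root_of_unity_def)

lemma powi_eq_1_iff_primitive:
  assumes "primitive_root_of_unity N \<zeta>"
  shows "\<zeta> powi k = 1 \<longleftrightarrow> int N dvd k"
  using power_eq_1_iff_primitive[OF assms]
  by (cases k rule: int_cases2) (simp_all add: power_int_minus)

lemma power_gcd_eq_1:
  fixes z :: "'a::field"
  assumes "z ^ a = 1" "z ^ b = 1"
  shows "z ^ gcd a b = 1"
proof (cases "a = 0")
  case False
  then obtain x y where "a * x = b * y + gcd a b"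
    using bezout_nat by blast
  hence "z ^ (a * x) = z ^ (b * y + gcd a b)"
    by simp
  thus ?thesis
    using assms by (simp add: power_add power_mult)
qed (use assms in simp)

lemma primitive_root_of_unity_prime_power:
  assumes "prime q" "\<zeta> ^ (q ^ Suc e) = 1" "\<zeta> ^ (q ^ e) \<noteq> 1"
  shows "primitive_root_of_unity (q ^ Suc e) \<zeta>"
  unfolding primitive_root_of_unity_def
proof (intro allI iffI)
  fix k assume "\<zeta> ^ k = 1"
  hence gcd: "\<zeta> ^ gcd k (q ^ Suc e) = 1"
    using assms(2) by (rule power_gcd_eq_1)
  obtain c where c: "c \<le> Suc e" "gcd k (q ^ Suc e) = q ^ c"
    using divides_primepow_nat[OF assms(1)] gcd_dvd2 by metis
  have "\<not> c \<le> e"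
  proof
    assume "c \<le> e"
    hence "q ^ e = q ^ c * q ^ (e - c)"
      by (simp flip: power_add)
    thus False
      using gcd[unfolded c(2)] assms(3) by (simp add: power_mult)
  qed
  hence "c = Suc e"
    using c(1) by simp
  thus "q ^ Suc e dvd k"
    using c(2) by (metis gcd_dvd1)
qed (use assms(2) in \<open>auto simp: power_mult elim!: dvdE\<close>)

lemma primitive_root_of_unity_mult:
  assumes "coprime a b" "primitive_root_of_unity a x" "primitive_root_of_unity b y"
  shows "primitive_root_of_unity (a * b) (x * y)"
  unfolding primitive_root_of_unity_def
proof (intro allI iffI)
  fix k assume "(x * y) ^ k = 1"
  hence "((x * y) ^ k) ^ b = 1" "((x * y) ^ k) ^ a = 1"
    by simp_all
  hence "x ^ (k * b) * y ^ (k * b) = 1" "x ^ (k * a) * y ^ (k * a) = 1"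
    by (simp_all only: power_mult_distrib power_mult)
  moreover have "y ^ (k * b) = 1" "x ^ (k * a) = 1"
    using assms(2,3) by (simp_all add: power_eq_1_iff_primitive)
  ultimately have "a dvd k * b" "b dvd k * a"
    using assms(2,3) by (simp_all add: power_eq_1_iff_primitive)
  hence "a dvd k" "b dvd k"
    using assms(1) by (simp_all add: coprime_dvd_mult_left_iff coprime_commute)
  thus "a * b dvd k"
    using assms(1) by (rule divides_mult)
next
  fix k assume "a * b dvd k"
  hence "x ^ k = 1" "y ^ k = 1"
    using assms(2,3) by (auto simp: power_eq_1_iff_primitive)
  thus "(x * y) ^ k = 1"
    by (simp add: power_mult_distrib)
qed

lemma mu_eq_roots: "mu N = {z :: 'a::field. poly (monom 1 N - 1) z = 0}"
  by (simp add: mu_def poly_monom)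

lemma degree_monom_minus_1: "degree (monom 1 N - 1 :: 'a::field poly) = N"
proof (cases "N = 0")
  case False
  hence "degree (monom (1 :: 'a) N + - 1) = degree (monom (1 :: 'a) N)"
    by (intro degree_add_eq_left) (simp add: degree_monom_eq)
  thus ?thesis
    by (simp add: degree_monom_eq)
qed simp

lemma
  assumes "N > 0"
  shows finite_mu: "finite (mu N :: 'a::field set)"
    and card_mu_le: "card (mu N :: 'a::field set) \<le> N"
proof -
  have "monom 1 N - 1 \<noteq> (0 :: 'a poly)"
    using degree_monom_minus_1[of N, where ?'a = 'a] assms by (metis degree_0 less_irrefl)
  from poly_roots_finite[OF this] card_poly_roots_bound[OF this]
  show "finite (mu N :: 'a set)" "card (mu N :: 'a set) \<le> N"
    unfolding mu_eq_roots by (simp_all add: degree_monom_minus_1)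
qed

lemma mu_nonzero: "\<zeta> \<in> mu N \<Longrightarrow> N > 0 \<Longrightarrow> \<zeta> \<noteq> 0"
  by (auto simp: mu_def power_0_left)

lemma card_mu:
  fixes \<eta> :: "'a::field"
  assumes "primitive_root_of_unity N \<eta>" "N > 0"
  shows "card (mu N :: 'a set) = N"
proof (rule antisym)
  have "\<eta> \<noteq> 0"
    using power_eq_1_iff_primitive[OF assms(1), of N] assms(2) by (auto simp: power_0_left)
  have "inj_on (\<lambda>i. \<eta> ^ i) {..<N}"
  proof (rule linorder_inj_onI')
    fix i j assume ij: "i \<in> {..<N}" "j \<in> {..<N}" "i < j"
    have "\<not> N dvd j - i"
      using ij by (auto dest: dvd_imp_le)
    hence "\<eta> ^ i * \<eta> ^ (j - i) \<noteq> \<eta> ^ i * 1"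
      using \<open>\<eta> \<noteq> 0\<close> power_eq_1_iff_primitive[OF assms(1)] by simp
    thus "\<eta> ^ i \<noteq> \<eta> ^ j"
      using ij by (simp flip: power_add)
  qed
  hence "N = card ((\<lambda>i. \<eta> ^ i) ` {..<N})"
    by (simp add: card_image)
  also have "\<dots> \<le> card (mu N :: 'a set)"
    using power_eq_1_iff_primitive[OF assms(1)] assms(2)
    by (intro card_mono finite_mu) (auto simp: mu_def simp flip: power_mult)
  finally show "N \<le> card (mu N :: 'a set)" .
qed (rule card_mu_le[OF assms(2)])

lemma sum_mu_powi:
  fixes \<eta> :: "'a::field"
  assumes "primitive_root_of_unity N \<eta>" "N > 0"
  shows "(\<Sum>\<zeta>\<in>mu N. \<zeta> powi k) = (if int N dvd k then of_nat N else (0 :: 'a))"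
proof (cases "int N dvd k")
  case True
  have "\<zeta> powi k = 1" if "\<zeta> \<in> mu N" for \<zeta> :: 'a
    using that True by (auto simp: mu_def power_int_mult)
  thus ?thesis
    using True card_mu[OF assms] by simp
next
  case False
  have "\<eta> ^ N = 1"
    using assms(1) by (simp add: power_eq_1_iff_primitive)
  hence "\<eta> \<noteq> 0"
    using assms(2) by (auto simp: power_0_left)
  have "bij_betw (\<lambda>\<zeta>. \<eta> * \<zeta>) (mu N) (mu N)"
    using \<open>\<eta> ^ N = 1\<close> \<open>\<eta> \<noteq> 0\<close> by (intro bij_betwI[of _ _ _ "\<lambda>\<zeta>. \<zeta> / \<eta>"])
      (auto simp: mu_def power_mult_distrib power_divide)
  hence "(\<Sum>\<zeta>\<in>mu N. \<zeta> powi k) = (\<Sum>\<zeta>\<in>mu N. (\<eta> * \<zeta>) powi k)"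
    by (rule sum.reindex_bij_betw[symmetric])
  also have "\<dots> = \<eta> powi k * (\<Sum>\<zeta>\<in>mu N. \<zeta> powi k)"
    by (simp add: power_int_mult_distrib sum_distrib_left)
  finally have "(\<eta> powi k - 1) * (\<Sum>\<zeta>\<in>mu N. \<zeta> powi k) = 0"
    by (simp add: algebra_simps)
  thus ?thesis
    using False powi_eq_1_iff_primitive[OF assms(1)] by simp
qed

lemma power_minus_1_eq_prod_mu:
  fixes c :: "'a::field"
  assumes "card (mu N :: 'a set) = N" "N > 0"
  shows "c ^ N - 1 = (\<Prod>\<omega>\<in>mu N. c - \<omega>)"
proof -
  let ?Q = "\<Prod>\<omega>\<in>mu N. [:- \<omega>, 1:] :: 'a poly"
  have degree: "degree ?Q = N"
    by (subst degree_prod_eq_sum_degree) (auto simp: assms)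
  have "lead_coeff ?Q = 1"
    by (subst lead_coeff_prod) simp
  have "monom 1 N - 1 = ?Q"
  proof (rule poly_eqI_degree_lead_coeff[where A = "mu N" and n = N])
    show "poly.coeff (monom 1 N - 1) N = poly.coeff ?Q N"
      using \<open>lead_coeff ?Q = 1\<close> assms(2) by (simp add: degree)
    show "poly (monom 1 N - 1) z = poly ?Q z" if "z \<in> mu N" for z
    proof -
      have "poly ?Q z = 0"
        using that finite_mu[OF assms(2), where ?'a = 'a] by (auto simp: poly_prod prod_zero_iff)
      thus ?thesis
        using that by (simp add: mu_eq_roots)
    qed
  qed (auto simp: degree degree_monom_minus_1 assms)
  hence "poly (monom 1 N - 1) c = poly ?Q c"
    by simp
  thus ?thesis
    by (simp add: poly_monom poly_prod)
qed

lemma ex_primitive_root_of_unity_prime_power: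
  assumes root: "\<And>f :: 'a::field_char_0 poly.
      (\<And>i. poly.coeff f i \<in> \<rat>) \<Longrightarrow> 0 < degree f \<Longrightarrow> \<exists>x. poly f x = 0"
    and "prime q"
  shows "\<exists>\<zeta> :: 'a. primitive_root_of_unity (q ^ Suc e) \<zeta>"
proof -
  define f :: "'a poly" where "f = (\<Sum>i<q. monom 1 (i * q ^ e))"
  have q: "q > 1"
    using assms(2) by (rule prime_gt_1_nat)
  have coeff: "poly.coeff f n = (\<Sum>i<q. if i * q ^ e = n then 1 else 0)" for n
    by (simp add: f_def coeff_sum)
  have "poly.coeff f (q ^ e) = (\<Sum>i<q. if i = 1 then 1 else 0)"
    unfolding coeff using q by (intro sum.cong) auto
  hence "poly.coeff f (q ^ e) \<noteq> 0"
    using q by simp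
  hence "q ^ e \<le> degree f"
    by (rule le_degree)
  hence "degree f > 0"
    using q by (metis gr0I le_zero_eq power_eq_0_iff not_one_less_zero)
  moreover have "poly.coeff f n \<in> \<rat>" for n
    unfolding coeff by (intro Rats_sum) auto
  ultimately obtain \<zeta> where "poly f \<zeta> = 0"
    using root by blast
  hence geometric: "(\<Sum>i<q. (\<zeta> ^ (q ^ e)) ^ i) = 0"
    by (simp add: f_def poly_sum poly_monom mult.commute flip: power_mult)
  hence "(\<zeta> ^ (q ^ e)) ^ q - 1 = 0"
    by (simp add: power_diff_1_eq)
  hence "\<zeta> ^ (q ^ Suc e) = 1"
    by (simp add: mult.commute flip: power_mult)
  moreover have "\<zeta> ^ (q ^ e) \<noteq> 1"
    using geometric q by auto
  ultimately show ?thesis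
    using primitive_root_of_unity_prime_power[OF assms(2)] by blast
qed

lemma ex_primitive_root_of_unity:
  assumes root: "\<And>f :: 'a::field_char_0 poly.
      (\<And>i. poly.coeff f i \<in> \<rat>) \<Longrightarrow> 0 < degree f \<Longrightarrow> \<exists>x. poly f x = 0"
    and "N > 0"
  shows "\<exists>\<zeta> :: 'a. primitive_root_of_unity N \<zeta>"
  using \<open>N > 0\<close>
proof (induction N rule: less_induct)
  case (less N)
  show ?case
  proof (cases "N = 1")
    case True
    thus ?thesis
      by (auto simp: primitive_root_of_unity_def intro!: exI[of _ 1])
  next
    case False
    then obtain q where q: "prime q" "q dvd N"
      using prime_factor_nat by blast
    obtain k m where factorization: "\<not> q dvd m" "N = m * q ^ k"
      using prime_power_canonical[OF q(1) less.prems] by blast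
    have "k > 0"
      using factorization q(2) by (cases k) auto
    then obtain \<xi> :: 'a where "primitive_root_of_unity (q ^ k) \<xi>"
      using ex_primitive_root_of_unity_prime_power[OF root q(1)] by (metis Suc_pred)
    moreover have "m > 0" "m < N"
      using less.prems factorization(2) one_less_power[OF prime_gt_1_nat[OF q(1)] \<open>k > 0\<close>] by auto
    then obtain \<eta> :: 'a where "primitive_root_of_unity m \<eta>"
      using less.IH by blast
    moreover have "coprime m (q ^ k)"
      using factorization(1) q(1)
      by (metis coprime_commute coprime_power_right_iff prime_imp_coprime)
    ultimately show ?thesis
      using factorization(2) primitive_root_of_unity_mult by metis
  qed
qed

section \<open>The residue characteristic\<close>

lemma power_times_geometric_tendsto_0:
  fixes r :: real
  assumes "0 \<le> r" "r < 1"
  shows "(\<lambda>n. real n ^ d * r ^ n) \<longlonglongrightarrow> 0"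
proof (cases "d = 0")
  case True
  thus ?thesis
    using assms by (simp add: LIMSEQ_realpow_zero)
next
  case False
  define s where "s = root d r"
  have s: "0 \<le> s" "s < 1" "r = s ^ d"
    using assms False by (simp_all add: s_def)
  have "(\<lambda>n. (real n * s ^ n) ^ d) \<longlonglongrightarrow> 0 ^ d"
    using s by (intro tendsto_power powser_times_n_limit_0) auto
  thus ?thesis
    using False by (simp add: s(3) power_mult_distrib power_0_left mult.commute flip: power_mult)
qed

locale padic_field =
  fixes p :: nat and ty :: "'a::nonarch_complete_field itself"
  assumes prime_p: "prime p"
    and absval_p: "absval (of_nat p :: 'a) = 1 / real p"
begin

lemma p_gt_1: "p > 1"
  using prime_p by (rule prime_gt_1_nat)

lemma absval_of_int_less_1_iff: "absval (of_int n :: 'a) < 1 \<longleftrightarrow> int p dvd n"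
proof
  have p: "of_nat p \<equiv>\<^sub>\<mm> (0 :: 'a)"
    using p_gt_1 by (simp add: residue_eq_0_iff absval_p)
  show "absval (of_int n :: 'a) < 1" if dvd: "int p dvd n"
  proof -
    obtain m where "n = int p * m"
      using dvd by blast
    moreover have "of_int m * of_nat p \<equiv>\<^sub>\<mm> (of_int m * 0 :: 'a)"
      by (intro residue_eq_scale p absval_of_int_le_1)
    ultimately show ?thesis
      by (simp add: residue_eq_0_iff mult.commute)
  qed
  show "int p dvd n" if "absval (of_int n :: 'a) < 1"
  proof (rule ccontr)
    assume "\<not> int p dvd n"
    hence "coprime n (int p)"
      using prime_p by (metis coprime_commute prime_imp_coprime prime_nat_int_transfer)
    then obtain a b where "a * n + b * int p = 1"
      using bezout_int[of n "int p"] by auto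
    hence "(1 :: 'a) = of_int a * of_int n + of_int b * of_nat p"
      by (metis of_int_1 of_int_add of_int_mult of_int_of_nat_eq)
    also have "\<dots> \<equiv>\<^sub>\<mm> of_int a * 0 + of_int b * 0"
      using that by (intro residue_eq_add residue_eq_scale p absval_of_int_le_1)
        (simp add: residue_eq_0_iff)
    finally show False
      by (simp add: residue_eq_0_iff)
  qed
qed

lemma absval_of_int_eq_1_iff: "absval (of_int n :: 'a) = 1 \<longleftrightarrow> \<not> int p dvd n"
  using absval_of_int_less_1_iff[of n] absval_of_int_le_1[of n, where ?'a = 'a] by linarith

lemma absval_of_nat_coprime:
  assumes "coprime n p"
  shows "absval (of_nat n :: 'a) = 1"
proof -
  have "\<not> p dvd n"
    using assms p_gt_1 by (metis coprime_absorb_right nat_dvd_1_iff_1 less_irrefl)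
  thus ?thesis
    using absval_of_int_eq_1_iff[of "int n"] by simp
qed

lemma of_int_residue_eq_mod: "of_int n \<equiv>\<^sub>\<mm> (of_int (n mod int p) :: 'a)"
  using absval_of_int_less_1_iff[of "n - n mod int p"] minus_mod_eq_mult_div[of n "int p"]
  by (metis dvd_triv_left of_int_diff residue_eq_def)

lemma absval_of_int:
  assumes "n \<noteq> 0"
  shows "absval (of_int n :: 'a) = 1 / real p ^ multiplicity (int p) n"
proof -
  have "\<not> is_unit (int p)"
    using prime_p by auto
  then obtain m where m: "n = int p ^ multiplicity (int p) n * m" "\<not> int p dvd m"
    using multiplicity_decompose'[OF assms] by blast
  have "absval (of_int n :: 'a) =
      absval (of_nat p :: 'a) ^ multiplicity (int p) n * absval (of_int m :: 'a)"
    by (subst m(1)) (simp add: absval_mult absval_power)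
  thus ?thesis
    using m(2) absval_of_int_eq_1_iff[of m] by (simp add: absval_p power_one_over)
qed

lemma absval_inverse_of_nat_le: "absval (1 / of_nat n :: 'a) \<le> real n"
proof (cases "n = 0")
  case False
  have "int p ^ multiplicity (int p) (int n) \<le> int n"
    using False by (intro zdvd_imp_le multiplicity_dvd) simp
  hence "real p ^ multiplicity (int p) (int n) \<le> real n"
    by (metis of_int_le_iff of_int_of_nat_eq of_int_power)
  thus ?thesis
    using False absval_of_int[of "int n"] by (simp add: absval_divide)
qed simp

lemma absval_inverse_power_of_nat_le:
  assumes "m \<le> n"
  shows "absval (1 / of_nat m ^ k :: 'a) \<le> real n ^ k"
proof -
  have "absval (1 / of_nat m ^ k :: 'a) = absval (1 / of_nat m :: 'a) ^ k"
    by (simp add: power_one_over flip: absval_power)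
  also have "\<dots> \<le> real n ^ k"
    using assms by (intro power_mono order_trans[OF absval_inverse_of_nat_le]) simp_all
  finally show ?thesis .
qed

lemma p_power_tendsto_0: "(\<lambda>k. of_nat (p ^ k) :: 'a) \<longlonglongrightarrow> 0"
proof -
  have "(\<lambda>k. (1 / real p) ^ k) \<longlonglongrightarrow> 0"
    using p_gt_1 by (intro LIMSEQ_realpow_zero) auto
  thus ?thesis
    by (simp add: tendsto_0_absval_iff absval_power absval_p)
qed

lemma residue_eq_power_p_add:
  fixes x y :: 'a
  assumes "absval x \<le> 1" "absval y \<le> 1"
  shows "(x + y) ^ p \<equiv>\<^sub>\<mm> x ^ p + y ^ p"
proof -
  have "(x + y) ^ p = (\<Sum>i\<le>p. of_nat (p choose i) * x ^ i * y ^ (p - i))"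
    by (rule binomial_ring)
  also have "\<dots> \<equiv>\<^sub>\<mm> (\<Sum>i\<le>p. if i \<in> {0, p} then x ^ i * y ^ (p - i) else 0)"
  proof (rule residue_eq_sum)
    fix i assume i: "i \<in> {..p}"
    show "of_nat (p choose i) * x ^ i * y ^ (p - i) \<equiv>\<^sub>\<mm>
        (if i \<in> {0, p} then x ^ i * y ^ (p - i) else 0)"
    proof (cases "i \<in> {0, p}")
      case False
      hence "p dvd p choose i"
        using i prime_p by (intro dvd_choose_prime) auto
      hence "of_nat (p choose i) \<equiv>\<^sub>\<mm> (0 :: 'a)"
        using absval_of_int_less_1_iff[of "int (p choose i)"] by (simp add: residue_eq_0_iff)
      moreover have "absval (x ^ i * y ^ (p - i)) \<le> 1"
        using assms by (simp add: absval_mult absval_power mult_le_one power_le_one)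
      ultimately have "x ^ i * y ^ (p - i) * of_nat (p choose i) \<equiv>\<^sub>\<mm> x ^ i * y ^ (p - i) * 0"
        by (rule residue_eq_scale)
      thus ?thesis
        using False by (simp add: mult_ac)
    qed auto
  qed
  also have "(\<Sum>i\<le>p. if i \<in> {0, p} then x ^ i * y ^ (p - i) else 0) =
      (\<Sum>i\<in>{0, p}. x ^ i * y ^ (p - i))"
    by (rule sum.mono_neutral_cong_right) auto
  also have "\<dots> = x ^ p + y ^ p"
    using p_gt_1 by (simp add: add.commute)
  finally show ?thesis .
qed

lemma residue_eq_if_p_powers:
  fixes x y :: 'a
  assumes "x ^ (p ^ s) \<equiv>\<^sub>\<mm> y ^ (p ^ s)" "absval x \<le> 1" "absval y \<le> 1"
  shows "x \<equiv>\<^sub>\<mm> y"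
  using assms
proof (induction s arbitrary: x y)
  case (Suc s)
  have "(x ^ p) ^ (p ^ s) \<equiv>\<^sub>\<mm> (y ^ p) ^ (p ^ s)"
    using Suc.prems(1) by (simp only: power_Suc power_mult)
  hence "x ^ p \<equiv>\<^sub>\<mm> y ^ p"
    by (rule Suc.IH) (use Suc.prems in \<open>simp_all add: absval_power power_le_one\<close>)
  have "absval (x - y) \<le> 1"
    using Suc.prems absval_add_le[of x 1 "- y"] by simp
  from residue_eq_power_p_add[OF this Suc.prems(3)] have "x ^ p \<equiv>\<^sub>\<mm> (x - y) ^ p + y ^ p"
    by simp
  hence "(x - y) ^ p + y ^ p \<equiv>\<^sub>\<mm> y ^ p"
    using \<open>x ^ p \<equiv>\<^sub>\<mm> y ^ p\<close> by (metis residue_eq_sym residue_eq_trans)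
  hence "absval (x - y) ^ p < 1"
    by (simp add: residue_eq_def absval_power)
  thus ?case
    using p_gt_1 by (simp add: residue_eq_def power_less_one_iff)
qed simp

section \<open>Values and residues of algebraic elements\<close>

lemma absval_Rats:
  assumes "x \<in> \<rat>" "x \<noteq> (0 :: 'a)"
  obtains k :: int where "absval x = real p powr of_int k"
proof -
  obtain a b where fraction: "b > 0" "x = of_int a / of_int b"
    using Rats_cases'[OF assms(1)] by metis
  have "absval x = real p powr (of_int (multiplicity (int p) b) - of_int (multiplicity (int p) a))"
    using fraction assms(2) p_gt_1 by (simp add: absval_divide absval_of_int powr_diff powr_realpow)
  thus thesis
    using that by (metis of_int_diff)
qed

lemma Qp_close_rational:
  assumes "x \<in> (Qp :: 'a set)" "0 < e"
  obtains q where "q \<in> \<rat>" "absval (x - q) < e"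
  using assms unfolding Qp_def closure_approachable
  by (metis dist_absval absval_minus_commute)

lemma absval_Qp:
  assumes "x \<in> (Qp :: 'a set)" "x \<noteq> 0"
  obtains k :: int where "absval x = real p powr of_int k"
proof -
  obtain q where q: "q \<in> \<rat>" "absval (x - q) < absval x"
    using Qp_close_rational[OF assms(1), of "absval x"] assms(2) by auto
  hence "absval q = absval x"
    by (intro absval_eq_if_close)
  thus thesis
    using absval_Rats[OF q(1)] assms(2) that by (metis absval_eq_0_iff)
qed

lemma absval_Qp_bar:
  assumes "b \<in> (Qp_bar :: 'a set)" "b \<noteq> 0"
  obtains r :: rat where "absval b = real p powr of_rat r"
proof -
  obtain f :: "'a poly" where f: "f \<noteq> 0" "\<And>i. poly.coeff f i \<in> Qp" "poly f b = 0"
    using assms(1) unfolding Qp_bar_def algebraic_over_def by blast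
  define g where "g i = poly.coeff f i * b ^ i" for i
  have "(\<Sum>i\<le>degree f. g i) = 0" "g (degree f) \<noteq> 0"
    using f(1,3) assms(2) by (simp_all add: g_def poly_altdef)
  then obtain i j where dominant: "i < j" "g i \<noteq> 0" "absval (g i) = absval (g j)"
    using sum_eq_0_imp_equal_absval[of "{..degree f}" g "degree f"]
    by (metis absval_eq_0_iff finite_atMost atMost_iff order_refl linorder_neqE_nat)
  hence "g j \<noteq> 0"
    by (metis absval_eq_0_iff)
  then obtain k l where coeff_values: "absval (poly.coeff f i) = real p powr of_int k"
      "absval (poly.coeff f j) = real p powr of_int l"
    using absval_Qp[OF f(2)] dominant(2) unfolding g_def by (metis mult_zero_left)
  define t where "t = log (real p) (absval b)"
  have b: "absval b = real p powr t"
    using assms(2) p_gt_1 by (simp add: t_def)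
  have "real p powr (of_int k + real i * t) = real p powr (of_int l + real j * t)"
    using dominant(3) p_gt_1
    by (simp add: g_def absval_mult absval_power coeff_values b powr_add powr_power mult.commute)
  hence "of_int k + real i * t = of_int l + real j * t"
    using p_gt_1 by (simp add: powr_inj)
  hence "t = (of_int k - of_int l) / (real j - real i)"
    using dominant(1) by (simp add: field_simps)
  hence "t = of_rat ((of_int k - of_int l) / (of_nat j - of_nat i))"
    by (simp add: of_rat_divide of_rat_diff)
  thus thesis
    using that b by blast
qed

lemma Rats_residue_int:
  assumes "x \<in> \<rat>" "absval (x :: 'a) \<le> 1"
  obtains n :: int where "x \<equiv>\<^sub>\<mm> of_int n"
proof -
  obtain a b :: int where fraction: "b > 0" "coprime a b" "x = of_int a / of_int b"
    using Rats_cases'[OF assms(1)] by metis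
  have "\<not> int p dvd b"
  proof
    assume "int p dvd b"
    hence "absval (of_int b :: 'a) < 1"
      by (simp add: absval_of_int_less_1_iff)
    moreover have "\<not> int p dvd a"
      using \<open>int p dvd b\<close> fraction(2) p_gt_1 by (metis coprime_common_divisor_int int_dvd_int_iff
          of_nat_1 nat_dvd_1_iff_1 abs_of_nat of_nat_eq_iff less_irrefl)
    ultimately show False
      using assms(2) fraction(1) absval_of_int_eq_1_iff[of a]
      by (simp add: fraction(3) absval_divide)
  qed
  hence b: "absval (of_int b :: 'a) = 1"
    by (simp add: absval_of_int_eq_1_iff)
  obtain u v :: int where "u * b + v * int p = 1"
    using \<open>\<not> int p dvd b\<close> prime_p bezout_int[of b "int p"]
    by (metis coprime_commute coprime_imp_gcd_eq_1 prime_imp_coprime prime_nat_int_transfer)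
  hence "int p dvd a - a * u * b"
    by (metis add_diff_cancel_left' dvd_mult dvd_triv_right mult.assoc mult.right_neutral
        right_diff_distrib)
  hence "of_int (a - a * u * b) \<equiv>\<^sub>\<mm> (0 :: 'a)"
    by (simp only: residue_eq_0_iff absval_of_int_less_1_iff)
  hence "inverse (of_int b) * of_int (a - a * u * b) \<equiv>\<^sub>\<mm> inverse (of_int b) * (0 :: 'a)"
    by (rule residue_eq_scale) (simp add: absval_inverse b)
  hence "x \<equiv>\<^sub>\<mm> of_int (a * u)"
    using fraction(1) by (simp add: residue_eq_def fraction(3) field_simps)
  thus thesis
    by (rule that)
qed

lemma Qp_rational_mult:
  assumes "s \<in> \<rat>" "x \<in> (Qp :: 'a set)"
  shows "s * x \<in> Qp"
proof -
  obtain f where "\<And>n. f n \<in> \<rat>" "f \<longlonglongrightarrow> x"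
    using assms(2) unfolding Qp_def closure_sequential by blast
  hence "\<And>n. s * f n \<in> \<rat>" "(\<lambda>n. s * f n) \<longlonglongrightarrow> s * x"
    using assms(1) by (auto intro!: tendsto_mult)
  thus ?thesis
    by (auto simp: Qp_def closure_sequential intro!: exI[of _ "\<lambda>n. s * f n"])
qed

lemma Qp_residue_int:
  assumes "x \<in> (Qp :: 'a set)" "absval x \<le> 1"
  obtains n :: int where "x \<equiv>\<^sub>\<mm> of_int n"
proof -
  obtain q where q: "q \<in> \<rat>" "x \<equiv>\<^sub>\<mm> q"
    using Qp_close_rational[OF assms(1) zero_less_one] by (auto simp: residue_eq_def)
  have "absval q \<le> 1"
    using absval_add_le[of "q - x" 1 x] q(2) assms(2)
    by (simp add: residue_eq_def absval_minus_commute)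
  then obtain n where "q \<equiv>\<^sub>\<mm> of_int n"
    using Rats_residue_int[OF q(1)] by blast
  thus thesis
    using that residue_eq_trans[OF q(2)] by blast
qed

lemma ex_dominant_coeff:
  fixes f :: "'a poly"
  assumes "f \<noteq> 0"
  obtains d where "poly.coeff f d \<noteq> 0"
    "\<And>j. absval (poly.coeff f j) \<le> absval (poly.coeff f d)"
    "\<And>j. j > d \<Longrightarrow> absval (poly.coeff f j) < absval (poly.coeff f d)"
proof -
  define M where "M = Max ((\<lambda>j. absval (poly.coeff f j)) ` {..degree f})"
  have coeff_le_M: "absval (poly.coeff f j) \<le> M" if "j \<le> degree f" for j
    using that by (auto simp: M_def)
  have "0 < absval (lead_coeff f)"
    using assms by simp
  hence "0 < M"
    using coeff_le_M[of "degree f"] by linarith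
  have bound: "absval (poly.coeff f j) \<le> M" for j
    using coeff_le_M[of j] \<open>0 < M\<close> by (cases "j \<le> degree f") (simp_all add: coeff_eq_0)
  let ?P = "\<lambda>j. absval (poly.coeff f j) = M"
  have "M \<in> (\<lambda>j. absval (poly.coeff f j)) ` {..degree f}"
    unfolding M_def by (rule Max_in) auto
  then obtain k where k: "?P k"
    by auto
  have maximal_le_degree: "j \<le> degree f" if "?P j" for j
    using that \<open>0 < M\<close> by (intro le_degree) auto
  define d where "d = (GREATEST j. ?P j)"
  have "?P d"
    unfolding d_def using k maximal_le_degree by (rule GreatestI_nat)
  moreover have "\<not> ?P j" if "j > d" for j
    using that Greatest_le_nat[of ?P j "degree f"] maximal_le_degree unfolding d_def by force
  ultimately show thesis
    using that[of d] bound \<open>0 < M\<close> by (metis absval_pos_iff less_le)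
qed

lemma Qp_bar_residue_monic_poly:
  assumes "b \<in> (Qp_bar :: 'a set)"
  obtains f :: "'a poly" and d where "poly f b = 0"
    "\<And>i. poly.coeff f i \<in> Qp" "\<And>i. absval (poly.coeff f i) \<le> 1"
    "poly.coeff f d \<equiv>\<^sub>\<mm> 1" "\<And>i. i > d \<Longrightarrow> poly.coeff f i \<equiv>\<^sub>\<mm> 0"
proof -
  obtain f :: "'a poly" where f: "f \<noteq> 0" "\<And>i. poly.coeff f i \<in> Qp" "poly f b = 0"
    using assms unfolding Qp_bar_def algebraic_over_def by blast
  obtain d where d: "poly.coeff f d \<noteq> 0"
      "\<And>j. absval (poly.coeff f j) \<le> absval (poly.coeff f d)"
      "\<And>j. j > d \<Longrightarrow> absval (poly.coeff f j) < absval (poly.coeff f d)"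
    using ex_dominant_coeff[OF f(1)] by blast
  obtain q where q: "q \<in> \<rat>" "absval (poly.coeff f d - q) < absval (poly.coeff f d)"
    using Qp_close_rational[OF f(2)[of d], of "absval (poly.coeff f d)"] d(1) by auto
  have absval_q: "absval q = absval (poly.coeff f d)"
    using q(2) by (rule absval_eq_if_close)
  hence "q \<noteq> 0"
    using d(1) by auto
  let ?g = "smult (inverse q) f"
  have absval_coeff:
    "absval (poly.coeff ?g i) = absval (poly.coeff f i) / absval (poly.coeff f d)" for i
    by (simp add: absval_mult absval_inverse absval_q divide_inverse mult.commute)
  have "poly.coeff ?g d - 1 = (poly.coeff f d - q) / q"
    using \<open>q \<noteq> 0\<close> by (simp add: field_simps)
  hence "poly.coeff ?g d \<equiv>\<^sub>\<mm> 1"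
    using q(2) d(1) by (simp only: residue_eq_def absval_divide absval_q) simp
  moreover have "poly.coeff ?g i \<equiv>\<^sub>\<mm> 0" if "i > d" for i
    unfolding residue_eq_0_iff absval_coeff using d(1) d(3)[OF that] by simp
  moreover have "absval (poly.coeff ?g i) \<le> 1" for i
    unfolding absval_coeff using d(1,2) by simp
  moreover have "poly.coeff ?g i \<in> Qp" for i
    using q(1) f(2) by (simp add: Qp_rational_mult)
  ultimately show thesis
    using that[of ?g d] f(3) by simp
qed

lemma Qp_bar_residue_integral:
  assumes "b \<in> (Qp_bar :: 'a set)" "absval b \<le> 1"
  obtains d and c :: "nat \<Rightarrow> int" where "b ^ d \<equiv>\<^sub>\<mm> (\<Sum>i<d. of_int (c i) * b ^ i)"
proof -
  obtain f :: "'a poly" and d where f: "poly f b = 0"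
      "\<And>i. poly.coeff f i \<in> Qp" "\<And>i. absval (poly.coeff f i) \<le> 1"
      "poly.coeff f d \<equiv>\<^sub>\<mm> 1" "\<And>i. i > d \<Longrightarrow> poly.coeff f i \<equiv>\<^sub>\<mm> 0"
    using Qp_bar_residue_monic_poly[OF assms(1)] by blast
  have "\<exists>n :: int. poly.coeff f i \<equiv>\<^sub>\<mm> of_int n" for i
    using Qp_residue_int[OF f(2,3)] by blast
  then obtain c :: "nat \<Rightarrow> int" where c: "\<And>i. poly.coeff f i \<equiv>\<^sub>\<mm> of_int (c i)"
    by metis
  define h :: "nat \<Rightarrow> 'a"
    where "h i = (if i < d then of_int (c i) else if i = d then 1 else 0)" for i
  have "poly.coeff f i \<equiv>\<^sub>\<mm> h i" for i
    using c f(4,5) by (cases i d rule: linorder_cases) (auto simp: h_def)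
  hence "(\<Sum>i\<le>degree f. b ^ i * poly.coeff f i) \<equiv>\<^sub>\<mm> (\<Sum>i\<le>degree f. b ^ i * h i)"
    using assms(2)
    by (intro residue_eq_sum residue_eq_scale) (simp_all add: absval_power power_le_one)
  also have "(\<Sum>i\<le>degree f. b ^ i * poly.coeff f i) = poly f b"
    by (simp add: poly_altdef mult.commute)
  also have "(\<Sum>i\<le>degree f. b ^ i * h i) = (\<Sum>i\<le>d. b ^ i * h i)"
  proof (rule sum.mono_neutral_right)
    have "poly.coeff f d \<noteq> 0"
      using f(4) by (auto simp: residue_eq_def)
    thus "{..d} \<subseteq> {..degree f}"
      by (auto dest: le_degree)
  qed (auto simp: h_def)
  also have "\<dots> = b ^ d - (\<Sum>i<d. of_int (- c i) * b ^ i)"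
    by (simp add: h_def sum_negf mult.commute flip: lessThan_Suc_atMost)
  finally have "b ^ d \<equiv>\<^sub>\<mm> (\<Sum>i<d. of_int (- c i) * b ^ i)"
    using f(1) by (simp add: residue_eq_sym residue_eq_iff_diff[of "b ^ d"])
  thus thesis
    by (rule that)
qed

lemma power_residue_combination:
  fixes b :: 'a
  assumes relation: "b ^ d \<equiv>\<^sub>\<mm> (\<Sum>i<d. of_int (c i) * b ^ i)" and "absval b \<le> 1"
  shows "\<exists>e :: nat \<Rightarrow> int. b ^ n \<equiv>\<^sub>\<mm> (\<Sum>i<d. of_int (e i) * b ^ i)"
proof (cases d)
  case 0
  thus ?thesis
    using relation by (simp add: residue_eq_0_iff)
next
  case (Suc d')
  show ?thesis
  proof (induction n)
    case 0
    have "(\<Sum>i<d. of_int (if i = 0 then 1 else 0) * b ^ i) = 1"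
      unfolding Suc by (subst sum.lessThan_Suc_shift) simp
    thus ?case
      by (intro exI[of _ "\<lambda>i. if i = 0 then 1 else 0"]) simp
  next
    case (Suc n)
    then obtain e :: "nat \<Rightarrow> int" where e: "b ^ n \<equiv>\<^sub>\<mm> (\<Sum>i<d. of_int (e i) * b ^ i)"
      by blast
    define e' where "e' i = (if i = 0 then 0 else e (i - 1)) + e d' * c i" for i
    have "b ^ Suc n \<equiv>\<^sub>\<mm> b * (\<Sum>i<d. of_int (e i) * b ^ i)"
      unfolding power_Suc using e assms(2) by (rule residue_eq_scale)
    also have "\<dots> = (\<Sum>i<d'. of_int (e i) * b ^ Suc i) + of_int (e d') * b ^ d"
      by (simp add: \<open>d = Suc d'\<close> sum_distrib_left distrib_left mult_ac)
    also have "\<dots> \<equiv>\<^sub>\<mm> (\<Sum>i<d'. of_int (e i) * b ^ Suc i) +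
        of_int (e d') * (\<Sum>i<d. of_int (c i) * b ^ i)"
      by (intro residue_eq_add residue_eq_refl residue_eq_scale relation absval_of_int_le_1)
    also have "(\<Sum>i<d'. of_int (e i) * b ^ Suc i) =
        (\<Sum>i<d. of_int (if i = 0 then 0 else e (i - 1)) * b ^ i)"
      unfolding \<open>d = Suc d'\<close> by (subst sum.lessThan_Suc_shift) simp
    also have "\<dots> + of_int (e d') * (\<Sum>i<d. of_int (c i) * b ^ i) = (\<Sum>i<d. of_int (e' i) * b ^ i)"
      by (simp add: e'_def sum_distrib_left sum.distrib distrib_right mult.assoc
          del: sum.lessThan_Suc)
    finally show ?case
      by blast
  qed
qed

lemma power_residue_digits:
  fixes b :: 'a
  assumes "b ^ d \<equiv>\<^sub>\<mm> (\<Sum>i<d. of_int (c i) * b ^ i)" "absval b \<le> 1"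
  shows "\<exists>e\<in>{..<d} \<rightarrow>\<^sub>E {0..<int p}. b ^ n \<equiv>\<^sub>\<mm> (\<Sum>i<d. of_int (e i) * b ^ i)"
proof -
  obtain e :: "nat \<Rightarrow> int" where e: "b ^ n \<equiv>\<^sub>\<mm> (\<Sum>i<d. of_int (e i) * b ^ i)"
    using power_residue_combination[OF assms] by blast
  define e' where "e' = restrict (\<lambda>i. e i mod int p) {..<d}"
  have "(\<Sum>i<d. b ^ i * of_int (e i)) \<equiv>\<^sub>\<mm> (\<Sum>i<d. b ^ i * of_int (e' i))"
    using assms(2) of_int_residue_eq_mod
    by (intro residue_eq_sum residue_eq_scale) (simp_all add: e'_def absval_power power_le_one)
  hence "b ^ n \<equiv>\<^sub>\<mm> (\<Sum>i<d. of_int (e' i) * b ^ i)"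
    using e by (auto simp: mult.commute intro: residue_eq_trans)
  moreover have "e' \<in> {..<d} \<rightarrow>\<^sub>E {0..<int p}"
    using p_gt_1 by (auto simp: e'_def)
  ultimately show ?thesis
    by blast
qed

lemma Qp_bar_unit_power_residue_eq_1:
  assumes "b \<in> (Qp_bar :: 'a set)" "absval b = 1"
  obtains n where "n > 0" "b ^ n \<equiv>\<^sub>\<mm> 1"
proof -
  obtain d and c :: "nat \<Rightarrow> int" where "b ^ d \<equiv>\<^sub>\<mm> (\<Sum>i<d. of_int (c i) * b ^ i)"
    using Qp_bar_residue_integral assms by (metis order_refl)
  hence "\<forall>n\<in>UNIV. \<exists>e\<in>{..<d} \<rightarrow>\<^sub>E {0..<int p}. b ^ n \<equiv>\<^sub>\<mm> (\<Sum>i<d. of_int (e i) * b ^ i)"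
    using power_residue_digits assms(2) by simp
  moreover have "finite ({..<d} \<rightarrow>\<^sub>E {0..<int p})"
    by (intro finite_PiE) auto
  ultimately obtain e where "infinite {n. b ^ n \<equiv>\<^sub>\<mm> (\<Sum>i<d. of_int (e i) * b ^ i)}"
    using pigeonhole_infinite_rel[OF infinite_UNIV_nat, of "{..<d} \<rightarrow>\<^sub>E {0..<int p}"
        "\<lambda>n e. b ^ n \<equiv>\<^sub>\<mm> (\<Sum>i<d. of_int (e i) * b ^ i)"] by auto
  then obtain k l where repetition: "k < l" "b ^ k \<equiv>\<^sub>\<mm> (\<Sum>i<d. of_int (e i) * b ^ i)"
      "b ^ l \<equiv>\<^sub>\<mm> (\<Sum>i<d. of_int (e i) * b ^ i)"
    by (metis (mono_tags, lifting) infinite_nat_iff_unbounded mem_Collect_eq)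
  hence "b ^ l \<equiv>\<^sub>\<mm> b ^ k"
    by (metis residue_eq_sym residue_eq_trans)
  hence "inverse (b ^ k) * b ^ l \<equiv>\<^sub>\<mm> inverse (b ^ k) * b ^ k"
    by (rule residue_eq_scale) (simp add: absval_inverse absval_power assms(2))
  moreover have "b \<noteq> 0"
    using assms(2) by auto
  ultimately have "b ^ (l - k) \<equiv>\<^sub>\<mm> 1"
    using repetition(1) by (simp add: power_diff field_simps)
  thus thesis
    using that repetition(1) by (metis zero_less_diff)
qed

end

section \<open>The logarithm on the principal units\<close>

lemma U0_iff_residue_eq_1: "u \<in> U0 \<longleftrightarrow> u \<equiv>\<^sub>\<mm> 1"
  by (simp add: U0_def residue_eq_def)

lemma U0_1: "1 \<in> U0"
  by (simp add: U0_iff_residue_eq_1)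

lemma U0_absval: "u \<in> U0 \<Longrightarrow> absval u = 1"
  by (simp add: U0_iff_residue_eq_1 absval_eq_1_residue_cong)

lemma U0_mult:
  assumes "u \<in> U0" "v \<in> U0"
  shows "u * v \<in> U0"
  using residue_eq_mult[of u 1 v 1] assms U0_absval[of u] by (simp add: U0_iff_residue_eq_1)

lemma U0_divide:
  assumes "u \<in> U0" "v \<in> U0"
  shows "u / v \<in> U0"
proof -
  have "u \<equiv>\<^sub>\<mm> v"
    using assms unfolding U0_iff_residue_eq_1 by (metis residue_eq_sym residue_eq_trans)
  moreover have "absval v = 1" "v \<noteq> 0"
    using U0_absval[OF assms(2)] by auto
  ultimately have "inverse v * u \<equiv>\<^sub>\<mm> inverse v * v"
    by (intro residue_eq_scale) (simp_all add: absval_inverse)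
  thus ?thesis
    using \<open>v \<noteq> 0\<close> by (simp add: U0_iff_residue_eq_1 field_simps)
qed

definition log_U0 :: "'a::nonarch_complete_field \<Rightarrow> 'a" where
  "log_U0 u = suminf (\<lambda>n. (-1) ^ n / of_nat (Suc n) * (u - 1) ^ Suc n)"

lemma log_U0_1 [simp]: "log_U0 1 = 0"
  by (simp add: log_U0_def)

text \<open>The constant coefficient is $1/0 = 0$.\<close>

definition neg_log_fps :: "'a::field_char_0 fps" where
  "neg_log_fps = Abs_fps (\<lambda>n. 1 / of_nat n)"

lemma power_minus_1_divide_eq_sum:
  fixes z :: "'a::field_char_0"
  shows "((1 + z) ^ Suc q - 1) / of_nat (Suc q) =
    (\<Sum>m\<le>q. of_nat (q choose m) / of_nat (Suc m) * z ^ Suc m)"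
proof -
  have coeff: "of_nat (Suc q choose Suc m) / of_nat (Suc q) =
      (of_nat (q choose m) / of_nat (Suc m) :: 'a)" for m
  proof -
    have "of_nat (Suc m) * of_nat (Suc q choose Suc m) =
        (of_nat (Suc q) * of_nat (q choose m) :: 'a)"
      using Suc_times_binomial[of m q] by (metis of_nat_mult)
    thus ?thesis
      by (simp add: field_simps del: of_nat_Suc binomial_Suc_Suc)
  qed
  have "(1 + z) ^ Suc q = (\<Sum>m\<le>Suc q. of_nat (Suc q choose m) * z ^ m)"
    using binomial_ring[of z 1 "Suc q"] by (simp add: add.commute)
  also have "\<dots> = 1 + (\<Sum>m\<le>q. of_nat (Suc q choose Suc m) * z ^ Suc m)"
    by (subst sum.atMost_Suc_shift) simp
  finally have "((1 + z) ^ Suc q - 1) / of_nat (Suc q) =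
      (\<Sum>m\<le>q. of_nat (Suc q choose Suc m) / of_nat (Suc q) * z ^ Suc m)"
    by (simp add: sum_divide_distrib del: binomial_Suc_Suc of_nat_Suc power_Suc)
  thus ?thesis
    unfolding coeff .
qed

context padic_field
begin

lemma neg_log_term_tendsto_0:
  fixes x :: 'a
  assumes "absval x < 1"
  shows "(\<lambda>n. fps_nth neg_log_fps n * x ^ n) \<longlonglongrightarrow> 0"
proof (rule tendsto_0_absval_le)
  show "(\<lambda>n. real n ^ 1 * absval x ^ n) \<longlonglongrightarrow> 0"
    using assms by (intro power_times_geometric_tendsto_0) simp_all
  show "absval (fps_nth neg_log_fps n * x ^ n) \<le> real n ^ 1 * absval x ^ n" for n
    using mult_right_mono[OF absval_inverse_of_nat_le[of n], of "absval x ^ n"]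
    by (simp add: neg_log_fps_def absval_divide absval_power)
qed

lemma log_U0_sums:
  fixes u :: 'a
  assumes "u \<in> U0"
  shows "(\<lambda>n. (-1) ^ n / of_nat (Suc n) * (u - 1) ^ Suc n) sums log_U0 u"
proof -
  have "(\<lambda>n. fps_nth neg_log_fps (Suc n) * (u - 1) ^ Suc n) \<longlonglongrightarrow> 0"
    using assms by (intro LIMSEQ_Suc neg_log_term_tendsto_0) (simp add: U0_def)
  hence "(\<lambda>n. (-1) ^ n / of_nat (Suc n) * (u - 1) ^ Suc n) \<longlonglongrightarrow> 0"
    by (simp add: tendsto_0_absval_iff neg_log_fps_def absval_mult absval_divide absval_power
        del: of_nat_Suc)
  thus ?thesis
    unfolding log_U0_def by (intro summable_sums) (simp add: summable_iff_tendsto_0)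
qed

lemma log_U0_1_minus_sums:
  fixes x :: 'a
  assumes "absval x < 1"
  shows "(\<lambda>n. fps_nth neg_log_fps n * x ^ n) sums - log_U0 (1 - x)"
proof -
  have "(\<lambda>n. -1 * ((-1) ^ n / of_nat (Suc n) * (1 - x - 1) ^ Suc n)) sums (-1 * log_U0 (1 - x))"
    using assms by (intro sums_mult_nonarch log_U0_sums) (simp add: U0_def)
  hence "(\<lambda>n. fps_nth neg_log_fps (Suc n) * x ^ Suc n) sums - log_U0 (1 - x)"
    by (simp add: neg_log_fps_def power_minus[of x] mult.left_commute[of _ x] del: of_nat_Suc)
  from sums_Suc[OF this] show ?thesis
    by (simp add: neg_log_fps_def)
qed

lemma binomial_p_power_minus_1_tendsto:
  "(\<lambda>k. of_nat ((p ^ k - 1) choose m) :: 'a) \<longlonglongrightarrow> (-1) ^ m"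
proof -
  have "(\<lambda>k. of_nat (p ^ k) - 1 :: 'a) \<longlonglongrightarrow> 0 - 1"
    by (intro tendsto_diff p_power_tendsto_0 tendsto_const)
  hence "(\<lambda>k. (of_nat (p ^ k) - 1 :: 'a) gchoose m) \<longlonglongrightarrow> (0 - 1) gchoose m"
    by (rule tendsto_gbinomial)
  moreover have "(0 - 1 :: 'a) gchoose m = (-1) ^ m"
    using gbinomial_minus[of "1 :: 'a" m] by (simp flip: binomial_gbinomial)
  moreover have "(of_nat (p ^ k) - 1 :: 'a) = of_nat (p ^ k - 1)" for k
    using p_gt_1 by (simp add: of_nat_diff)
  ultimately show ?thesis
    by (simp only: binomial_gbinomial)
qed

lemma log_U0_eq_limit:
  fixes u :: 'a
  assumes "u \<in> U0"
  shows "(\<lambda>k. (u ^ (p ^ k) - 1) / of_nat (p ^ k)) \<longlonglongrightarrow> log_U0 u"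
proof -
  define z where "z = u - 1"
  have z: "absval z < 1"
    using assms by (simp add: U0_def z_def)
  define f where "f k m = of_nat ((p ^ k - 1) choose m) / of_nat (Suc m) * z ^ Suc m" for k m
  show ?thesis
  proof (rule tannerys_theorem_nonarch[where f = f])
    show "(\<lambda>k. f k m) \<longlonglongrightarrow> (-1) ^ m / of_nat (Suc m) * z ^ Suc m" for m
      using tendsto_mult[OF binomial_p_power_minus_1_tendsto
          tendsto_const[of "1 / of_nat (Suc m) * z ^ Suc m"]]
      by (simp add: f_def)
    have "absval (f k m) \<le> absval (fps_nth neg_log_fps (Suc m) * z ^ Suc m)" for k m
      using mult_right_mono[OF absval_of_nat_le_1[of "(p ^ k - 1) choose m", where ?'a = 'a],
          of "absval (fps_nth neg_log_fps (Suc m) * z ^ Suc m)"]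
      by (simp add: f_def neg_log_fps_def absval_mult absval_divide del: of_nat_Suc)
    thus "eventually (\<lambda>k. \<forall>m. absval (f k m) \<le> absval (fps_nth neg_log_fps (Suc m) * z ^ Suc m))
        sequentially"
      by simp
    show "(\<lambda>m. absval (fps_nth neg_log_fps (Suc m) * z ^ Suc m)) \<longlonglongrightarrow> 0"
      using LIMSEQ_Suc[OF neg_log_term_tendsto_0[OF z]] unfolding tendsto_0_absval_iff .
    show "eventually (\<lambda>k. f k sums ((u ^ (p ^ k) - 1) / of_nat (p ^ k))) sequentially"
    proof (intro always_eventually allI)
      fix k
      obtain q where q: "p ^ k = Suc q"
        using p_gt_1 by (cases "p ^ k") auto
      have "f k sums (\<Sum>m\<le>q. f k m)"
        by (rule sums_finite) (auto simp: f_def q)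
      also have "(\<Sum>m\<le>q. f k m) = (u ^ (p ^ k) - 1) / of_nat (p ^ k)"
        using power_minus_1_divide_eq_sum[of z q]
        by (simp add: f_def q z_def del: of_nat_Suc power_Suc)
      finally show "f k sums ((u ^ (p ^ k) - 1) / of_nat (p ^ k))" .
    qed
    show "(\<lambda>m. (-1) ^ m / of_nat (Suc m) * z ^ Suc m) sums log_U0 u"
      unfolding z_def using assms by (rule log_U0_sums)
  qed
qed

lemma log_U0_mult:
  fixes u v :: 'a
  assumes "u \<in> U0" "v \<in> U0"
  shows "log_U0 (u * v) = log_U0 u + log_U0 v"
proof (rule LIMSEQ_unique)
  define q :: "nat \<Rightarrow> 'a" where "q k = of_nat (p ^ k)" for k
  define g where "g u k = (u ^ (p ^ k) - 1) / q k" for u k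
  have lim: "g u \<longlonglongrightarrow> log_U0 u" if "u \<in> U0" for u
    unfolding g_def q_def using that by (rule log_U0_eq_limit)
  show "g (u * v) \<longlonglongrightarrow> log_U0 (u * v)"
    by (intro lim U0_mult assms)
  have "(\<lambda>k. g u k + g v k + q k * (g u k * g v k)) \<longlonglongrightarrow>
      log_U0 u + log_U0 v + 0 * (log_U0 u * log_U0 v)"
    unfolding q_def by (intro tendsto_add tendsto_mult lim assms p_power_tendsto_0)
  moreover have "g u k + g v k + q k * (g u k * g v k) = g (u * v) k" for k
  proof -
    have "q k \<noteq> 0"
      using p_gt_1 by (simp add: q_def)
    thus ?thesis
      by (simp add: g_def power_mult_distrib divide_simps) (simp add: algebra_simps)
  qed
  ultimately show "g (u * v) \<longlonglongrightarrow> log_U0 u + log_U0 v"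
    by simp
qed

end

section \<open>The decomposition of the multiplicative group\<close>

context padic_field
begin

lemma absval_mu_ur:
  assumes "\<omega> \<in> (mu_ur p :: 'a set)"
  shows "absval \<omega> = 1"
proof -
  obtain n where "n > 0" "\<omega> ^ n = 1"
    using assms by (auto simp: mu_ur_def)
  hence "absval \<omega> ^ n = 1"
    by (metis absval_1 absval_power)
  thus ?thesis
    using \<open>n > 0\<close> power_eq_1_iff[of "absval \<omega>" n] by simp
qed

lemma mu_subset_mu_ur: "coprime N p \<Longrightarrow> N > 0 \<Longrightarrow> mu N \<subseteq> (mu_ur p :: 'a set)"
  by (auto simp: mu_def mu_ur_def)

lemma mu_ur_mult:
  assumes "\<omega> \<in> (mu_ur p :: 'a set)" "\<eta> \<in> mu_ur p"
  shows "\<omega> * \<eta> \<in> mu_ur p"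
proof -
  obtain m n where orders: "m > 0" "n > 0" "coprime m p" "coprime n p" "\<omega> ^ m = 1" "\<eta> ^ n = 1"
    using assms by (auto simp: mu_ur_def)
  have "(\<omega> * \<eta>) ^ (m * n) = (\<omega> ^ m) ^ n * (\<eta> ^ n) ^ m"
    by (simp add: power_mult_distrib mult.commute flip: power_mult)
  also have "\<dots> = 1"
    using orders by simp
  finally show ?thesis
    using orders unfolding mu_ur_def by (intro CollectI exI[of _ "m * n"]) simp
qed

lemma mu_ur_inverse: "\<omega> \<in> (mu_ur p :: 'a set) \<Longrightarrow> inverse \<omega> \<in> mu_ur p"
  by (auto simp: mu_ur_def power_inverse)

lemma mu_ur_inter_U0:
  assumes "\<omega> \<in> (mu_ur p :: 'a set)" "\<omega> \<in> U0"
  shows "\<omega> = 1"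
proof (rule ccontr)
  assume "\<omega> \<noteq> 1"
  obtain n where n: "coprime n p" "\<omega> ^ n = 1"
    using assms(1) by (auto simp: mu_ur_def)
  have "(\<omega> - 1) * (\<Sum>i<n. \<omega> ^ i) = 0"
    using n(2) power_diff_1_eq[of \<omega> n] by simp
  hence "0 = (\<Sum>i<n. \<omega> ^ i)"
    using \<open>\<omega> \<noteq> 1\<close> by simp
  also have "\<dots> \<equiv>\<^sub>\<mm> (\<Sum>i<n. 1 ^ i)"
    using assms(2) U0_absval[of \<omega>]
    by (intro residue_eq_sum residue_eq_power) (simp_all add: U0_iff_residue_eq_1)
  finally have "absval (of_nat n :: 'a) < 1"
    by (simp add: residue_eq_def)
  thus False
    using absval_of_nat_coprime[OF n(1)] by simp
qed

end

locale Cp_field = padic_field p ty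
  for p :: nat and ty :: "'a::nonarch_complete_field itself" +
  fixes pw :: "rat \<Rightarrow> 'a"
  assumes alg_closed: "alg_closed_subset (Qp_bar :: 'a set)"
    and dense: "closure (Qp_bar :: 'a set) = UNIV"
    and p_power: "is_p_power p pw"
begin

lemma rational_poly_has_root:
  fixes f :: "'a poly"
  assumes "\<And>i. poly.coeff f i \<in> \<rat>" "0 < degree f"
  shows "\<exists>x. poly f x = 0"
proof -
  have "c \<in> Qp_bar" if "c \<in> \<rat>" for c :: 'a
  proof -
    have "poly.coeff [:- c, 1:] i \<in> \<rat>" for i
      using that by (auto simp: coeff_pCons split: nat.splits)
    hence "\<forall>i. poly.coeff [:- c, 1:] i \<in> Qp"
      using closure_subset unfolding Qp_def by blast
    thus ?thesis
      unfolding Qp_bar_def algebraic_over_def by (intro CollectI exI[of _ "[:- c, 1:]"]) simp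
  qed
  thus ?thesis
    using alg_closed assms unfolding alg_closed_subset_def by blast
qed

lemma ex_primitive_root:
  assumes "N > 0"
  obtains \<eta> :: 'a where "primitive_root_of_unity N \<eta>"
  using ex_primitive_root_of_unity[OF rational_poly_has_root assms] by blast

lemma Qp_bar_close:
  fixes a :: 'a
  assumes "0 < e"
  obtains b where "b \<in> Qp_bar" "absval (a - b) < e"
  using closure_approachable[of a "Qp_bar :: 'a set"] dense assms
  by (metis UNIV_I absval_minus_commute dist_absval)

lemma absval_rational_power:
  assumes "a \<noteq> (0 :: 'a)"
  obtains r :: rat where "absval a = real p powr of_rat r"
proof -
  obtain b where b: "b \<in> Qp_bar" "absval (a - b) < absval a"
    using Qp_bar_close[of "absval a" a] assms by auto
  have "absval b = absval a"
    using b(2) by (rule absval_eq_if_close)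
  thus thesis
    using absval_Qp_bar[OF b(1)] assms that by (metis absval_eq_0_iff)
qed

lemma mu_ur_residue_system:
  fixes c :: 'a
  assumes "absval c = 1"
  obtains \<omega> where "\<omega> \<in> mu_ur p" "c \<equiv>\<^sub>\<mm> \<omega>"
proof -
  obtain b where b: "b \<in> Qp_bar" "c \<equiv>\<^sub>\<mm> b"
    using Qp_bar_close[OF zero_less_one] by (metis residue_eq_def)
  have "absval b = 1"
    using absval_eq_1_residue_cong[OF b(2)] assms by simp
  then obtain n where n: "n > 0" "b ^ n \<equiv>\<^sub>\<mm> 1"
    using Qp_bar_unit_power_residue_eq_1[OF b(1)] by blast
  obtain s m where factorization: "\<not> p dvd m" "n = m * p ^ s"
    using prime_power_canonical[OF prime_p n(1)] by blast
  hence m: "coprime m p" "m > 0"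
    using prime_p n(1) by (auto simp: coprime_commute[of m] intro: prime_imp_coprime)
  have "(c ^ m) ^ p ^ s \<equiv>\<^sub>\<mm> (b ^ m) ^ p ^ s"
    using b(2) assms \<open>absval b = 1\<close> by (intro residue_eq_power) (simp_all add: absval_power)
  also have "(b ^ m) ^ p ^ s \<equiv>\<^sub>\<mm> 1 ^ p ^ s"
    using n(2) by (simp add: factorization(2) power_mult)
  finally have "c ^ m \<equiv>\<^sub>\<mm> 1"
    by (rule residue_eq_if_p_powers) (simp_all add: absval_power assms)
  moreover obtain \<eta> :: 'a where "primitive_root_of_unity m \<eta>"
    using ex_primitive_root[OF m(2)] .
  hence "c ^ m - 1 = (\<Prod>\<omega>\<in>mu m. c - \<omega>)"
    using m(2) by (intro power_minus_1_eq_prod_mu card_mu)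
  ultimately have "(\<Prod>\<omega>\<in>mu m. absval (c - \<omega>)) < 1"
    by (simp add: residue_eq_def absval_prod)
  then obtain \<omega> where "\<omega> \<in> mu m" "absval (c - \<omega>) < 1"
    using prod_ge_1[of "mu m" "\<lambda>\<omega>. absval (c - \<omega>)"] by (meson not_le)
  thus thesis
    using that mu_subset_mu_ur[OF m] by (auto simp: residue_eq_def)
qed

lemma pw_add: "pw (r + s) = pw r * pw s" and pw_1: "pw 1 = of_nat p"
  using p_power by (auto simp: is_p_power_def)

lemma pw_nonzero [simp]: "pw r \<noteq> 0"
proof
  assume "pw r = 0"
  hence "of_nat p = (0 :: 'a)"
    using pw_add[of r "1 - r"] by (simp add: pw_1)
  thus False
    using p_gt_1 by simp
qed

lemma pw_diff: "pw (r - s) = pw r / pw s"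
  using pw_add[of "r - s" s] by (simp add: field_simps)

lemma pw_0: "pw 0 = 1"
  using pw_diff[of 0 0] by simp

lemma pw_of_nat_mult: "pw (of_nat n * r) = pw r ^ n"
  by (induction n) (simp_all add: pw_0 pw_add algebra_simps)

lemma pw_of_int: "pw (of_int k) = of_nat p powi k"
proof -
  have nat: "pw (of_nat n) = of_nat p ^ n" for n
    using pw_of_nat_mult[of n 1] by (simp add: pw_1)
  have "pw (of_int (int m - int n)) = of_nat p powi (int m - int n)" for m n
    using p_gt_1 by (simp add: pw_diff nat power_int_diff)
  thus ?thesis
    by (metis int_diff_cases)
qed

lemma absval_pw: "absval (pw r) = real p powr - of_rat r"
proof -
  obtain a b where fraction: "quotient_of r = (a, b)"
    by fastforce
  have b: "b > 0" and r: "r = of_int a / of_int b"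
    using fraction quotient_of_denom_pos quotient_of_div by blast+
  have "of_nat (nat b) * r = of_int a"
    using b by (simp add: r)
  hence "pw r ^ nat b = of_nat p powi a"
    by (metis pw_of_int pw_of_nat_mult)
  hence "absval (pw r) ^ nat b = (1 / real p) powi a"
    by (metis absval_p absval_power absval_power_int)
  also have "\<dots> = real p powr - of_int a"
    using p_gt_1 by (simp add: power_int_inverse powr_minus powr_real_of_int' divide_inverse)
  also have "\<dots> = (real p powr - of_rat r) ^ nat b"
    using b p_gt_1 by (simp add: r powr_power of_rat_divide)
  finally show ?thesis
    by (rule power_eq_imp_eq_base) (use b in simp_all)
qed

lemma decomposition:
  fixes a :: 'a
  assumes "a \<noteq> 0"
  obtains r \<omega> u where "\<omega> \<in> mu_ur p" "u \<in> U0" "a = pw r * \<omega> * u"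
proof -
  obtain r where "absval a = real p powr of_rat r"
    using absval_rational_power[OF assms] by blast
  hence "absval (a / pw (- r)) = 1"
    using p_gt_1 by (simp add: absval_divide absval_pw of_rat_minus)
  then obtain \<omega> where \<omega>: "\<omega> \<in> mu_ur p" "a / pw (- r) \<equiv>\<^sub>\<mm> \<omega>"
    using mu_ur_residue_system by blast
  have "absval \<omega> = 1"
    using \<omega>(1) by (rule absval_mu_ur)
  hence "\<omega> \<noteq> 0"
    by auto
  have "inverse \<omega> * (a / pw (- r)) \<equiv>\<^sub>\<mm> inverse \<omega> * \<omega>"
    using \<omega>(2) by (rule residue_eq_scale) (simp add: absval_inverse \<open>absval \<omega> = 1\<close>)
  hence "inverse \<omega> * (a / pw (- r)) \<in> U0"
    using \<open>\<omega> \<noteq> 0\<close> by (simp add: U0_iff_residue_eq_1)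
  with \<omega>(1) show thesis
    by (rule that[of _ _ "- r"]) (simp add: \<open>\<omega> \<noteq> 0\<close>)
qed

lemma pw_times_mu_ur_in_U0:
  assumes "\<omega> \<in> mu_ur p" "pw r * \<omega> \<in> U0"
  shows "pw r * \<omega> = 1"
proof -
  have "real p powr - of_rat r = 1"
    using U0_absval[OF assms(2)] absval_mu_ur[OF assms(1)] by (simp add: absval_mult absval_pw)
  hence "r = 0"
    using p_gt_1 by (simp add: powr_eq_one_iff)
  thus ?thesis
    using mu_ur_inter_U0 assms by (simp add: pw_0)
qed

lemma U0_part_eq:
  assumes "\<omega> \<in> mu_ur p" "u \<in> U0"
  shows "U0_part p pw (pw r * \<omega> * u) = u"
  unfolding U0_part_def
proof (rule the_equality)
  show "u \<in> U0 \<and> (\<exists>r'. \<exists>\<omega>'\<in>mu_ur p. pw r * \<omega> * u = pw r' * \<omega>' * u)"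
    using assms by blast
  fix v
  assume "v \<in> U0 \<and> (\<exists>r'. \<exists>\<omega>'\<in>mu_ur p. pw r * \<omega> * u = pw r' * \<omega>' * v)"
  then obtain r' \<omega>' where v: "v \<in> U0" "\<omega>' \<in> mu_ur p" and eq: "pw r * \<omega> * u = pw r' * \<omega>' * v"
    by blast
  have nonzero: "\<omega>' \<noteq> 0" "u \<noteq> 0"
    using absval_mu_ur[OF v(2)] U0_absval[OF assms(2)] by auto
  have quotient: "pw (r - r') * (\<omega> * inverse \<omega>') = v / u"
    using eq nonzero by (simp add: pw_diff field_simps)
  moreover have "v / u \<in> U0"
    using v(1) assms(2) by (rule U0_divide)
  ultimately have "v / u = 1"
    using pw_times_mu_ur_in_U0 mu_ur_mult[OF assms(1) mu_ur_inverse[OF v(2)]] by metis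
  thus "v = u"
    using nonzero by simp
qed

section \<open>The logarithm on the multiplicative group\<close>

lemma log_p_decomposition:
  assumes "\<omega> \<in> mu_ur p" "u \<in> U0"
  shows "log_p p pw (pw r * \<omega> * u) = log_U0 u"
  by (simp add: log_p_def log_U0_def U0_part_eq[OF assms])

lemma log_p_mult:
  assumes "a \<noteq> 0" "b \<noteq> 0"
  shows "log_p p pw (a * b) = log_p p pw a + log_p p pw b"
proof -
  obtain r \<omega> u where a: "\<omega> \<in> mu_ur p" "u \<in> U0" "a = pw r * \<omega> * u"
    using decomposition[OF assms(1)] .
  obtain s \<eta> v where b: "\<eta> \<in> mu_ur p" "v \<in> U0" "b = pw s * \<eta> * v"
    using decomposition[OF assms(2)] .
  have "a * b = pw (r + s) * (\<omega> * \<eta>) * (u * v)"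
    by (simp add: a(3) b(3) pw_add mult_ac)
  hence "log_p p pw (a * b) = log_U0 (u * v)"
    using a(1,2) b(1,2) by (simp only: log_p_decomposition mu_ur_mult U0_mult)
  thus ?thesis
    using a b by (simp add: log_p_decomposition log_U0_mult)
qed

lemma log_p_U0:
  assumes "u \<in> U0"
  shows "log_p p pw u = log_U0 u"
proof -
  have "1 \<in> (mu_ur p :: 'a set)"
    by (auto simp: mu_ur_def intro!: exI[of _ 1])
  from log_p_decomposition[OF this assms, of 0] show ?thesis
    by (simp add: pw_0)
qed

lemma log_p_1: "log_p p pw 1 = 0"
  by (simp add: log_p_U0 U0_1)

lemma log_p_power: "a \<noteq> 0 \<Longrightarrow> log_p p pw (a ^ n) = of_nat n * log_p p pw a"
  by (induction n) (simp_all add: log_p_1 log_p_mult distrib_right)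

lemma log_p_mu:
  assumes "\<zeta> \<in> mu N" "N > 0"
  shows "log_p p pw \<zeta> = 0"
  using log_p_power[OF mu_nonzero[OF assms], of N] assms by (simp add: mu_def log_p_1)

lemma log_p_minus: "a \<noteq> 0 \<Longrightarrow> log_p p pw (- a) = log_p p pw a"
  using log_p_mult[of "-1" a] log_p_mu[of "-1" 2] by (simp add: mu_def)

lemma log_p_quadratic:
  assumes "\<zeta> \<in> mu N" "N > 0" "\<alpha> \<noteq> 0" "absval (\<zeta> / \<alpha>) < 1" "absval (\<beta> / \<zeta>) < 1"
  shows "log_p p pw ((\<zeta> - \<alpha>) * (\<zeta> - \<beta>)) =
    log_p p pw \<alpha> + log_U0 (1 - \<zeta> / \<alpha>) + log_U0 (1 - \<beta> / \<zeta>)"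
proof -
  have "\<zeta> \<noteq> 0"
    using assms(1,2) by (rule mu_nonzero)
  have U0: "1 - \<zeta> / \<alpha> \<in> U0" "1 - \<beta> / \<zeta> \<in> U0"
    using assms(4,5) by (simp_all add: U0_def)
  hence nonzero: "1 - \<zeta> / \<alpha> \<noteq> 0" "1 - \<beta> / \<zeta> \<noteq> 0"
    using U0_absval absval_0 zero_neq_one by metis+
  have "(\<zeta> - \<alpha>) * (\<zeta> - \<beta>) = - \<alpha> * (1 - \<zeta> / \<alpha>) * (\<zeta> * (1 - \<beta> / \<zeta>))"
    using \<open>\<alpha> \<noteq> 0\<close> \<open>\<zeta> \<noteq> 0\<close> by (simp add: field_simps)
  also have "log_p p pw \<dots> =
      log_p p pw (- \<alpha>) + log_p p pw (1 - \<zeta> / \<alpha>) + (log_p p pw \<zeta> + log_p p pw (1 - \<beta> / \<zeta>))"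
    using \<open>\<alpha> \<noteq> 0\<close> \<open>\<zeta> \<noteq> 0\<close> nonzero
    by (simp only: log_p_mult mult_eq_0_iff neg_equal_0_iff_equal simp_thms)
  also have "log_p p pw (- \<alpha>) = log_p p pw \<alpha>"
    using \<open>\<alpha> \<noteq> 0\<close> by (rule log_p_minus)
  finally show ?thesis
    using log_p_mu[OF assms(1,2)] U0 by (simp add: log_p_U0)
qed

end

section \<open>Means over roots of unity\<close>

definition mu_mean :: "nat \<Rightarrow> ('a \<Rightarrow> 'a) \<Rightarrow> 'a::field" where
  "mu_mean N F = (\<Sum>\<zeta>\<in>mu N. F \<zeta>) / of_nat N"

lemma mu_mean_cong: "(\<And>\<zeta>. \<zeta> \<in> mu N \<Longrightarrow> F \<zeta> = G \<zeta>) \<Longrightarrow> mu_mean N F = mu_mean N G"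
  by (simp add: mu_mean_def)

lemma mu_mean_mult: "mu_mean N (\<lambda>\<zeta>. c * F \<zeta>) = c * mu_mean N F"
  by (simp add: mu_mean_def sum_distrib_left)

lemma mu_mean_sum: "mu_mean N (\<lambda>\<zeta>. \<Sum>i\<in>I. F i \<zeta>) = (\<Sum>i\<in>I. mu_mean N (F i))"
  unfolding mu_mean_def sum_divide_distrib by (rule sum.swap)

lemma mu_mean_sums:
  fixes F :: "'a::nonarch_complete_field \<Rightarrow> 'a"
  assumes "\<And>\<zeta>. \<zeta> \<in> mu N \<Longrightarrow> (\<lambda>m. h m \<zeta>) sums F \<zeta>"
  shows "(\<lambda>m. mu_mean N (h m)) sums mu_mean N F"
proof -
  have "(\<lambda>m. inverse (of_nat N) * (\<Sum>\<zeta>\<in>mu N. h m \<zeta>)) sums (inverse (of_nat N) * (\<Sum>\<zeta>\<in>mu N. F \<zeta>))"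
    by (intro sums_mult_nonarch sums_sum assms)
  thus ?thesis
    by (simp add: mu_mean_def divide_inverse_commute)
qed

context padic_field
begin

abbreviation coprime_at_top :: "nat filter" where
  "coprime_at_top \<equiv> inf sequentially (principal {N. coprime N p})"

lemma eventually_coprime_at_top:
  "eventually P coprime_at_top \<longleftrightarrow> (\<exists>M. \<forall>N\<ge>M. coprime N p \<longrightarrow> P N)"
  by (simp add: eventually_inf_principal eventually_sequentially)

lemma eventually_coprime_at_topI:
  assumes "\<And>N. coprime N p \<Longrightarrow> N > M \<Longrightarrow> P N"
  shows "eventually P coprime_at_top"
  unfolding eventually_coprime_at_top using assms by (intro exI[of _ "Suc M"]) auto

lemma coprime_at_top_neq_bot: "coprime_at_top \<noteq> bot"
proof
  assume "coprime_at_top = bot"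
  hence "eventually (\<lambda>_. False) coprime_at_top"
    by simp
  then obtain M where M: "\<not> coprime N p" if "N \<ge> M" for N
    by (auto simp: eventually_coprime_at_top)
  have "coprime (M * p + 1) p"
    using gcd_add_mult[of p M 1] by (simp add: coprime_iff_gcd_eq_1 gcd.commute)
  moreover have "M * p + 1 \<ge> M"
    using mult_le_mono2[of 1 p M] p_gt_1 by linarith
  ultimately show False
    using M by blast
qed

lemma absval_mu_mean_le:
  fixes F :: "'a \<Rightarrow> 'a"
  assumes "coprime N p" "N > 0" "\<And>\<zeta>. absval \<zeta> = 1 \<Longrightarrow> absval (F \<zeta>) \<le> c"
  shows "absval (mu_mean N F) \<le> c"
proof -
  have "0 \<le> c"
    using assms(3)[of 1] order_trans[OF absval_nonneg] by auto
  hence "absval (\<Sum>\<zeta>\<in>mu N. F \<zeta>) \<le> c"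
    using absval_mu_ur mu_subset_mu_ur[OF assms(1,2)] by (intro absval_sum_le assms(3)) auto
  thus ?thesis
    by (simp add: mu_mean_def absval_divide absval_of_nat_coprime[OF assms(1)])
qed

lemma mu_mean_tendsto_suminf:
  fixes h :: "nat \<Rightarrow> 'a \<Rightarrow> 'a"
  assumes lim: "\<And>m. ((\<lambda>N. mu_mean N (h m)) \<longlongrightarrow> l m) coprime_at_top"
    and bound: "\<And>m \<zeta>. absval \<zeta> = 1 \<Longrightarrow> absval (h m \<zeta>) \<le> b m" and vanishing: "b \<longlonglongrightarrow> 0"
    and sums: "\<And>\<zeta>. absval \<zeta> = 1 \<Longrightarrow> (\<lambda>m. h m \<zeta>) sums F \<zeta>" "l sums s"
  shows "((\<lambda>N. mu_mean N F) \<longlongrightarrow> s) coprime_at_top"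
proof (rule tannerys_theorem_nonarch[OF lim _ vanishing _ sums(2)])
  show "\<forall>\<^sub>F N in coprime_at_top. \<forall>m. absval (mu_mean N (h m)) \<le> b m"
    by (rule eventually_coprime_at_topI[of 0]) (simp add: absval_mu_mean_le bound)
  show "\<forall>\<^sub>F N in coprime_at_top. (\<lambda>m. mu_mean N (h m)) sums mu_mean N F"
  proof (rule eventually_coprime_at_topI[of 0])
    fix N assume N: "coprime N p" "N > 0"
    show "(\<lambda>m. mu_mean N (h m)) sums mu_mean N F"
      using absval_mu_ur mu_subset_mu_ur[OF N] by (intro mu_mean_sums sums(1)) auto
  qed
qed

end

context Cp_field
begin

lemma mu_mean_powi_tendsto:
  "((\<lambda>N. mu_mean N (\<lambda>\<zeta>. \<zeta> powi k)) \<longlongrightarrow> (if k = 0 then 1 else 0 :: 'a)) coprime_at_top"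
proof (rule tendsto_eventually, rule eventually_coprime_at_topI)
  fix N assume N: "N > nat \<bar>k\<bar>"
  hence "N > 0"
    by simp
  obtain \<eta> :: 'a where \<eta>: "primitive_root_of_unity N \<eta>"
    using ex_primitive_root[OF \<open>N > 0\<close>] .
  have "int N dvd k \<longleftrightarrow> k = 0"
    using N dvd_imp_le_int[of k "int N"] by (cases "k = 0") auto
  thus "mu_mean N (\<lambda>\<zeta>. \<zeta> powi k) = (if k = 0 then 1 else 0 :: 'a)"
    using sum_mu_powi[OF \<eta> \<open>N > 0\<close>, of k] \<open>N > 0\<close> by (simp add: mu_mean_def)
qed

lemma mu_mean_power_mult_tendsto:
  fixes b :: "nat \<Rightarrow> 'a"
  assumes G: "\<And>\<zeta>. absval \<zeta> = 1 \<Longrightarrow> (\<lambda>n. b n * inverse \<zeta> ^ n) sums G \<zeta>"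
  shows "((\<lambda>N. mu_mean N (\<lambda>\<zeta>. \<zeta> ^ m * G \<zeta>)) \<longlongrightarrow> b m) coprime_at_top"
proof (rule mu_mean_tendsto_suminf)
  show "((\<lambda>N. mu_mean N (\<lambda>\<zeta>. b n * \<zeta> powi (int m - int n))) \<longlongrightarrow>
      b n * (if int m - int n = 0 then 1 else 0)) coprime_at_top" for n
    unfolding mu_mean_mult by (intro tendsto_mult tendsto_const mu_mean_powi_tendsto)
  show "absval (b n * \<zeta> powi (int m - int n)) \<le> absval (b n)" if "absval \<zeta> = 1" for n and \<zeta> :: 'a
    using that by (simp add: absval_mult absval_power_int)
  show "(\<lambda>n. absval (b n)) \<longlonglongrightarrow> 0"
    using sums_imp_tendsto_0[OF G[of 1]] by (simp flip: tendsto_0_absval_iff)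
  show "(\<lambda>n. b n * \<zeta> powi (int m - int n)) sums (\<zeta> ^ m * G \<zeta>)" if "absval \<zeta> = 1" for \<zeta>
  proof -
    have "\<zeta> \<noteq> 0"
      using that by auto
    thus ?thesis
      using sums_mult_nonarch[OF G[OF that], of "\<zeta> ^ m"]
      by (simp add: power_int_diff power_inverse divide_inverse mult_ac)
  qed
  show "(\<lambda>n. b n * (if int m - int n = 0 then 1 else 0)) sums b m"
  proof -
    have "(\<lambda>n. b n * (if int m - int n = 0 then 1 else 0)) = (\<lambda>n. if n = m then b n else 0)"
      by auto
    thus ?thesis
      using sums_single[of m b] by simp
  qed
qed

lemma mu_mean_mult_tendsto:
  fixes a b :: "nat \<Rightarrow> 'a"
  assumes F: "\<And>\<zeta>. absval \<zeta> = 1 \<Longrightarrow> (\<lambda>n. a n * \<zeta> ^ n) sums F \<zeta>"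
    and G: "\<And>\<zeta>. absval \<zeta> = 1 \<Longrightarrow> (\<lambda>n. b n * inverse \<zeta> ^ n) sums G \<zeta>"
  shows "((\<lambda>N. mu_mean N (\<lambda>\<zeta>. F \<zeta> * G \<zeta>)) \<longlongrightarrow> suminf (\<lambda>n. a n * b n)) coprime_at_top"
proof -
  have a: "a \<longlonglongrightarrow> 0" and b: "b \<longlonglongrightarrow> 0"
    using sums_imp_tendsto_0[OF F[of 1]] sums_imp_tendsto_0[OF G[of 1]] by simp_all
  obtain K where K: "0 < K" "\<And>n. absval (b n) \<le> K"
    using tendsto_0_imp_absval_bounded[OF b] by blast
  have G_bound: "absval (G \<zeta>) \<le> K" if "absval \<zeta> = 1" for \<zeta>
    using K(2) that by (intro absval_sums_le[OF G[OF that]])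
      (simp add: absval_mult absval_power absval_inverse)
  show ?thesis
  proof (rule mu_mean_tendsto_suminf)
    show "((\<lambda>N. mu_mean N (\<lambda>\<zeta>. a m * (\<zeta> ^ m * G \<zeta>))) \<longlongrightarrow> a m * b m) coprime_at_top" for m
      unfolding mu_mean_mult by (intro tendsto_mult tendsto_const mu_mean_power_mult_tendsto G)
    show "absval (a m * (\<zeta> ^ m * G \<zeta>)) \<le> absval (a m) * K" if "absval \<zeta> = 1" for m \<zeta>
      using G_bound[OF that] that by (simp add: absval_mult absval_power mult_left_mono)
    show "(\<lambda>m. absval (a m) * K) \<longlonglongrightarrow> 0"
      using a by (intro tendsto_mult_left_zero) (simp flip: tendsto_0_absval_iff)
    show "(\<lambda>m. a m * (\<zeta> ^ m * G \<zeta>)) sums (F \<zeta> * G \<zeta>)" if "absval \<zeta> = 1" for \<zeta>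
      using sums_mult_nonarch[OF F[OF that], of "G \<zeta>"] by (simp add: mult_ac)
    have "(\<lambda>m. a m * b m) \<longlonglongrightarrow> 0 * 0"
      by (intro tendsto_mult a b)
    thus "(\<lambda>m. a m * b m) sums suminf (\<lambda>m. a m * b m)"
      by (intro summable_sums) (simp add: summable_iff_tendsto_0)
  qed
qed

end

section \<open>Truncated multiple harmonic sums\<close>

fun mhs :: "nat \<Rightarrow> nat \<Rightarrow> index \<Rightarrow> 'a::field_char_0" where
  "mhs n a [] = 1"
| "mhs n a (k # v) = (\<Sum>m\<in>{a<..<n}. 1 / of_nat m ^ k * mhs n m v)"

definition mhs_H1 :: "nat \<Rightarrow> nat \<Rightarrow> H1 \<Rightarrow> 'a::field_char_0" where
  "mhs_H1 n a w = (\<Sum>u\<in>Poly_Mapping.keys w. of_rat (Poly_Mapping.lookup w u) * mhs n a u)"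

lemma mhs_H1_add: "mhs_H1 n a (v + w) = mhs_H1 n a v + mhs_H1 n a w"
  unfolding mhs_H1_def
  by (rule setsum_keys_plus_distrib) (simp_all add: of_rat_add distrib_right)

lemma mhs_H1_single: "mhs_H1 n a (Poly_Mapping.single u c) = of_rat c * mhs n a u"
  by (simp add: mhs_H1_def)

lemma mhs_H1_sum: "mhs_H1 n a (sum g A) = (\<Sum>x\<in>A. mhs_H1 n a (g x))"
  by (induction A rule: infinite_finite_induct) (simp_all add: mhs_H1_add, simp_all add: mhs_H1_def)

lemma mhs_H1_lmult_e:
  "mhs_H1 n a (lmult_e k w) = (\<Sum>m\<in>{a<..<n}. 1 / of_nat m ^ k * mhs_H1 n m w)"
proof -
  have "mhs_H1 n a (lmult_e k w) =
      (\<Sum>u\<in>Poly_Mapping.keys w. \<Sum>m\<in>{a<..<n}.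
        1 / of_nat m ^ k * (of_rat (Poly_Mapping.lookup w u) * mhs n m u))"
    by (simp add: lmult_e_def mhs_H1_sum mhs_H1_single sum_distrib_left mult_ac)
  also have "\<dots> = (\<Sum>m\<in>{a<..<n}. 1 / of_nat m ^ k * mhs_H1 n m w)"
    by (subst sum.swap) (simp add: mhs_H1_def sum_distrib_left)
  finally show ?thesis .
qed

lemma sum_mult_split_order:
  fixes f g :: "'i::linorder \<Rightarrow> 'b::comm_semiring_0"
  assumes "finite A"
  shows "sum f A * sum g A =
    (\<Sum>x\<in>A. f x * sum g {y\<in>A. x < y}) + (\<Sum>y\<in>A. g y * sum f {x\<in>A. y < x}) + (\<Sum>x\<in>A. f x * g x)"
proof -
  have split: "sum g A = sum g {y\<in>A. x < y} + sum g {y\<in>A. y < x} + g x" if "x \<in> A" for x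
  proof -
    have "sum g ({y\<in>A. x < y} \<union> {y\<in>A. y < x} \<union> {x}) =
        sum g {y\<in>A. x < y} + sum g {y\<in>A. y < x} + g x"
      using assms by (subst sum.union_disjoint; (subst sum.union_disjoint)?) auto
    also have "{y\<in>A. x < y} \<union> {y\<in>A. y < x} \<union> {x} = A"
      using that by auto
    finally show ?thesis .
  qed
  have "sum f A * sum g A = (\<Sum>x\<in>A. f x * sum g A)"
    by (rule sum_distrib_right)
  also have "\<dots> = (\<Sum>x\<in>A. f x * (sum g {y\<in>A. x < y} + sum g {y\<in>A. y < x} + g x))"
    using split by (intro sum.cong) auto
  also have "\<dots> = (\<Sum>x\<in>A. f x * sum g {y\<in>A. x < y}) +
      (\<Sum>x\<in>A. f x * sum g {y\<in>A. y < x}) + (\<Sum>x\<in>A. f x * g x)"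
    by (simp add: distrib_left sum.distrib)
  also have "(\<Sum>x\<in>A. f x * sum g {y\<in>A. y < x}) = (\<Sum>y\<in>A. g y * sum f {x\<in>A. y < x})"
    using sum.swap_restrict[OF assms assms, of "\<lambda>x y. f x * g y" "\<lambda>x y. y < x"]
    by (simp add: sum_distrib_left mult.commute)
  finally show ?thesis .
qed

lemma mhs_mult: "mhs n a v * mhs n a w = mhs_H1 n a (harmonic_word v w)"
proof (induction v w arbitrary: a rule: harmonic_word.induct)
  case (3 k v l w)
  let ?e = "\<lambda>k m. 1 / of_nat m ^ k :: 'a"
  have above: "{m'. a < m' \<and> m' < n \<and> m < m'} = {m<..<n}" if "a < m" for m
    using that by auto
  have "mhs n a (k # v) * mhs n a (l # w) =
      (\<Sum>m\<in>{a<..<n}. ?e k m * mhs n m v * mhs n m (l # w)) +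
      (\<Sum>m\<in>{a<..<n}. ?e l m * mhs n m w * mhs n m (k # v)) +
      (\<Sum>m\<in>{a<..<n}. (?e k m * mhs n m v) * (?e l m * mhs n m w))"
    unfolding mhs.simps sum_mult_split_order[OF finite_greaterThanLessThan] by (simp add: above)
  also have "(\<Sum>m\<in>{a<..<n}. ?e k m * mhs n m v * mhs n m (l # w)) =
      mhs_H1 n a (lmult_e k (harmonic_word v (l # w)))"
    unfolding mhs_H1_lmult_e "3.IH"(1)[symmetric] by (simp only: mult.assoc)
  also have "(\<Sum>m\<in>{a<..<n}. ?e l m * mhs n m w * mhs n m (k # v)) =
      mhs_H1 n a (lmult_e l (harmonic_word (k # v) w))"
    unfolding mhs_H1_lmult_e "3.IH"(2)[symmetric] by (simp only: mult_ac)
  also have "(\<Sum>m\<in>{a<..<n}. (?e k m * mhs n m v) * (?e l m * mhs n m w)) =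
      mhs_H1 n a (lmult_e (k + l) (harmonic_word v w))"
    unfolding mhs_H1_lmult_e "3.IH"(3)[symmetric] by (simp add: power_add mult_ac)
  finally show ?case
    by (simp only: harmonic_word.simps mhs_H1_add)
qed (simp_all add: word_def mhs_H1_single)

lemma mhs_snoc: "mhs n a (u @ [k]) = (\<Sum>m\<in>{a<..<n}. 1 / of_nat m ^ k * mhs m a u)"
proof (induction u arbitrary: a)
  case (Cons l u)
  let ?e = "\<lambda>k m. 1 / of_nat m ^ k :: 'a"
  have above: "{m. a < m \<and> m < n \<and> x < m} = {x<..<n}" if "a < x" for x
    using that by auto
  have below: "{x. a < x \<and> x < n \<and> x < m} = {a<..<m}" if "m < n" for m
    using that by auto
  have "mhs n a ((l # u) @ [k]) =
      (\<Sum>x\<in>{a<..<n}. \<Sum>m | m \<in> {a<..<n} \<and> x < m. ?e l x * (?e k m * mhs m x u))"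
    by (simp add: Cons.IH sum_distrib_left above)
  also have "\<dots> = (\<Sum>m\<in>{a<..<n}. \<Sum>x | x \<in> {a<..<n} \<and> x < m. ?e l x * (?e k m * mhs m x u))"
    by (rule sum.swap_restrict) auto
  also have "\<dots> = (\<Sum>m\<in>{a<..<n}. ?e k m * mhs m a (l # u))"
    by (simp add: below sum_distrib_left mult_ac)
  finally show ?case .
qed simp

definition sorted_lists :: "nat \<Rightarrow> nat \<Rightarrow> nat \<Rightarrow> nat list set" where
  "sorted_lists n a l = {ms. length ms = l \<and> sorted_wrt (<) ms \<and> set ms \<subseteq> {a<..<n}}"

lemma finite_sorted_lists: "finite (sorted_lists n a l)"
  by (rule finite_subset[OF _ finite_lists_length_eq[of "{a<..<n}" l]])
     (auto simp: sorted_lists_def)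

lemma sorted_lists_0: "sorted_lists n a 0 = {[]}"
  by (auto simp: sorted_lists_def)

lemma sorted_lists_Suc:
  "sorted_lists n a (Suc l) = (\<Union>m\<in>{a<..<n}. (#) m ` sorted_lists n m l)"
  by (auto simp: sorted_lists_def subset_iff length_Suc_conv image_iff)

definition mhs_term :: "index \<Rightarrow> nat list \<Rightarrow> 'a::field" where
  "mhs_term ks ms = (\<Prod>i<length ks. 1 / of_nat (ms ! i) ^ (ks ! i))"

lemma mhs_term_Cons: "mhs_term (k # ks) (m # ms) = 1 / of_nat m ^ k * mhs_term ks ms"
  by (simp add: mhs_term_def prod.lessThan_Suc_shift del: prod.lessThan_Suc)

lemma mhs_term_snoc:
  "length ms = length ks \<Longrightarrow> mhs_term (ks @ [k]) (ms @ [m]) = 1 / of_nat m ^ k * mhs_term ks ms"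
  by (simp add: mhs_term_def nth_append)

lemma mhs_eq_sum_sorted_lists:
  "mhs n a ks = (sum (mhs_term ks) (sorted_lists n a (length ks)) :: 'a::field_char_0)"
proof (induction ks arbitrary: a)
  case Nil
  show ?case
    by (simp add: sorted_lists_0 mhs_term_def)
next
  case (Cons k ks)
  have "sum (mhs_term (k # ks)) (sorted_lists n a (length (k # ks))) =
      (\<Sum>m\<in>{a<..<n}. sum (mhs_term (k # ks)) ((#) m ` sorted_lists n m (length ks)) :: 'a)"
    unfolding list.size add_Suc_right add_0_right sorted_lists_Suc
    by (rule sum.UNION_disjoint) (auto simp: finite_sorted_lists)
  also have "\<dots> = (\<Sum>m\<in>{a<..<n}. 1 / of_nat m ^ k * mhs n m ks)"
    by (simp add: sum.reindex mhs_term_Cons Cons.IH sum_distrib_left)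
  finally show ?case
    by simp
qed

section \<open>Powers of the logarithm\<close>

lemma neg_log_fps_deriv: "fps_deriv neg_log_fps = Abs_fps (\<lambda>_. 1)"
  by (simp add: neg_log_fps_def fps_eq_iff del: of_nat_Suc)

lemma fps_nth_neg_log_power_Suc_Suc:
  "of_nat (Suc n) * fps_nth (neg_log_fps ^ Suc i) (Suc n) =
    (of_nat (Suc i) * (\<Sum>m\<le>n. fps_nth (neg_log_fps ^ i) m) :: 'a::field_char_0)"
proof -
  have "of_nat (Suc n) * fps_nth (neg_log_fps ^ Suc i) (Suc n) =
      fps_nth (fps_deriv (neg_log_fps ^ Suc i :: 'a fps)) n"
    by (simp del: power_Suc of_nat_Suc)
  also have "\<dots> = fps_nth (fps_const (of_nat (Suc i)) * (neg_log_fps ^ i * Abs_fps (\<lambda>_. 1))) n"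
    by (simp add: fps_deriv_power neg_log_fps_deriv mult_ac del: power_Suc of_nat_Suc)
  also have "\<dots> = of_nat (Suc i) * (\<Sum>m\<le>n. fps_nth (neg_log_fps ^ i) m)"
    by (simp add: fps_mult_left_const_nth fps_mult_nth[of "_ ^ _"] atMost_atLeast0 del: of_nat_Suc)
  finally show ?thesis .
qed

lemma fps_nth_neg_log_power_0: "fps_nth (neg_log_fps ^ i) 0 = (if i = 0 then 1 else 0)"
  by (simp add: neg_log_fps_def fps_nth_power_0 power_0_left)

lemma fps_nth_neg_log_power:
  "fps_nth (neg_log_fps ^ Suc i) n = fact (Suc i) / of_nat n * mhs n 0 (replicate i 1)"
proof (induction i arbitrary: n)
  case 0
  show ?case
    by (simp add: neg_log_fps_def)
next
  case (Suc i)
  show ?case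
  proof (cases n)
    case 0
    thus ?thesis
      by (simp only: fps_nth_neg_log_power_0) simp
  next
    case (Suc n')
    have "of_nat n * fps_nth (neg_log_fps ^ Suc (Suc i)) n =
        of_nat (Suc (Suc i)) * (\<Sum>m\<le>n'. fact (Suc i) / of_nat m * mhs m 0 (replicate i 1) :: 'a)"
      unfolding Suc fps_nth_neg_log_power_Suc_Suc Suc.IH ..
    also have "(\<Sum>m\<le>n'. fact (Suc i) / of_nat m * mhs m 0 (replicate i 1) :: 'a) =
        (\<Sum>m\<in>{0<..<n}. fact (Suc i) / of_nat m * mhs m 0 (replicate i 1))"
      by (rule sum.mono_neutral_right) (auto simp: Suc)
    also have "\<dots> = fact (Suc i) * mhs n 0 (replicate i 1 @ [1])"
      by (simp add: mhs_snoc sum_distrib_left mult_ac del: fact_Suc)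
    finally show ?thesis
      using Suc by (simp add: replicate_append_same field_simps del: power_Suc of_nat_Suc)
  qed
qed

context padic_field
begin

lemma log_U0_power_sums:
  fixes x :: 'a
  assumes "absval x < 1"
  shows "(\<lambda>n. fps_nth (neg_log_fps ^ i) n * x ^ n) sums ((- log_U0 (1 - x)) ^ i)"
  using log_U0_1_minus_sums[OF assms] by (rule fps_power_sums)

end

section \<open>Multiple polylogarithms\<close>

lemma increasing_lists_eq_UN_snoc:
  "{ms :: nat list. length ms = Suc l \<and> sorted_wrt (<) ms \<and> (\<forall>m\<in>set ms. 0 < m)} =
    (\<Union>n. (\<lambda>ms. ms @ [Suc n]) ` sorted_lists (Suc n) 0 l)" (is "?I = ?U")
proof (intro equalityI subsetI)
  fix ms assume ms: "ms \<in> ?I"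
  hence "ms \<noteq> []"
    by auto
  then obtain ms' m where snoc: "ms = ms' @ [m]"
    by (metis append_butlast_last_id)
  with ms obtain n where "m = Suc n"
    by (cases m) auto
  moreover have "ms' \<in> sorted_lists m 0 l"
    using ms by (auto simp: snoc sorted_lists_def sorted_wrt_append)
  ultimately show "ms \<in> ?U"
    using snoc by blast
qed (auto simp: sorted_lists_def sorted_wrt_append subset_iff)

lemma sum_mhs_term_snoc:
  fixes t :: "'a::field_char_0"
  shows "(\<Sum>ms\<in>(\<lambda>ms. ms @ [m]) ` sorted_lists m a (length u). mhs_term (u @ [k]) ms * t ^ last ms) =
    1 / of_nat m ^ k * mhs m a u * t ^ m"
proof -
  have "(\<Sum>ms\<in>(\<lambda>ms. ms @ [m]) ` sorted_lists m a (length u). mhs_term (u @ [k]) ms * t ^ last ms) =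
      (\<Sum>ms\<in>sorted_lists m a (length u). 1 / of_nat m ^ k * mhs_term u ms * t ^ m)"
    by (auto simp: sum.reindex inj_on_def mhs_term_snoc sorted_lists_def intro!: sum.cong)
  thus ?thesis
    by (simp add: mhs_eq_sum_sorted_lists sum_distrib_left sum_distrib_right)
qed

lemma harmonic_word_word: "word v \<^bold>* word w = harmonic_word v w"
proof -
  have "Poly_Mapping.map (\<lambda>c. c) x = x" for x :: H1
    by (rule poly_mapping_eqI) (simp add: Poly_Mapping.map.rep_eq when_def)
  thus ?thesis
    by (simp add: harmonic_def word_def)
qed

definition hadamard_eval :: "'a fps \<Rightarrow> 'a fps \<Rightarrow> 'a \<Rightarrow> 'a::nonarch_complete_field" where
  "hadamard_eval f g t = suminf (\<lambda>n. fps_nth f n * fps_nth g n * t ^ n)"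

lemma hadamard_eval_commute: "hadamard_eval f g t = hadamard_eval g f t"
  by (simp add: hadamard_eval_def mult.commute)

lemma hadamard_eval_1: "hadamard_eval 1 g t = fps_nth g 0"
proof -
  have "(\<lambda>n. fps_nth 1 n * fps_nth g n * t ^ n) sums (\<Sum>n\<in>{0}. fps_nth 1 n * fps_nth g n * t ^ n)"
    by (rule sums_finite) auto
  thus ?thesis
    by (simp add: hadamard_eval_def sums_unique[symmetric])
qed

lemma hadamard_eval_neg_log_powers_boundary:
  assumes "i = 0 \<or> j = 0"
  shows "hadamard_eval (neg_log_fps ^ i) (neg_log_fps ^ j) t = (if i = j then 1 else 0)"
  using assms
  by (auto simp: hadamard_eval_1 fps_nth_neg_log_power_0
      hadamard_eval_commute[of "neg_log_fps ^ i" 1])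

context padic_field
begin

lemma absval_mhs_term_le:
  assumes "length ms = length ks" "set ms \<subseteq> {..n}"
  shows "absval (mhs_term ks ms :: 'a) \<le> real n ^ sum_list ks"
proof -
  have "ms ! i \<le> n" if "i < length ks" for i
    using that assms by (metis atMost_iff nth_mem subsetD)
  hence "absval (mhs_term ks ms :: 'a) \<le> (\<Prod>i<length ks. real n ^ (ks ! i))"
    unfolding mhs_term_def absval_prod
    by (intro prod_mono) (simp add: absval_inverse_power_of_nat_le)
  also have "\<dots> = real n ^ sum_list ks"
    by (simp add: power_sum sum_list_sum_nth atLeast0LessThan)
  finally show ?thesis .
qed

lemma Li_snoc_sums:
  fixes t :: 'a
  assumes "absval t < 1" "0 < k"
  shows "(\<lambda>n. 1 / of_nat n ^ k * mhs n 0 u * t ^ n) sums Li (u @ [k]) t"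
proof -
  define F where "F ms = mhs_term (u @ [k]) ms * t ^ last ms" for ms
  define B where "B n = (\<lambda>ms. ms @ [Suc n]) ` sorted_lists (Suc n) 0 (length u)" for n
  have "(\<lambda>n. sum F (B n)) sums infsum F (\<Union>n. B n)"
  proof (rule sums_infsum_nonarch)
    show "finite (B n)" for n
      by (simp add: B_def finite_sorted_lists)
    show "disjoint_family B"
      by (auto simp: disjoint_family_on_def B_def)
    show "absval (F ms) \<le> real (Suc n) ^ sum_list (u @ [k]) * absval t ^ Suc n"
      if "ms \<in> B n" for n ms
    proof -
      have "length ms = length (u @ [k])" "set ms \<subseteq> {..Suc n}" "last ms = Suc n"
        using that by (auto simp: B_def sorted_lists_def)
      thus ?thesis
        using absval_mhs_term_le[of ms "u @ [k]" "Suc n"]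
        by (simp add: F_def absval_mult absval_power mult_right_mono)
    qed
    show "(\<lambda>n. real (Suc n) ^ sum_list (u @ [k]) * absval t ^ Suc n) \<longlonglongrightarrow> 0"
      using assms(1) by (intro LIMSEQ_Suc power_times_geometric_tendsto_0) simp_all
  qed
  also have "infsum F (\<Union>n. B n) = Li (u @ [k]) t"
    unfolding Li_def B_def F_def length_append_singleton increasing_lists_eq_UN_snoc
    by (simp add: mhs_term_def prod_dividef)
  finally have "(\<lambda>n. 1 / of_nat (Suc n) ^ k * mhs (Suc n) 0 u * t ^ Suc n) sums Li (u @ [k]) t"
    unfolding F_def B_def sum_mhs_term_snoc .
  from sums_Suc[OF this] show ?thesis
    using assms(2) by (simp add: power_0_left)
qed

lemma Li_append2_sums:
  fixes t :: 'a
  assumes "absval t < 1"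
  shows "(\<lambda>n. 1 / of_nat n ^ 2 * mhs_H1 n 0 w * t ^ n) sums Li_append2 w t"
proof -
  have "(\<lambda>n. \<Sum>u\<in>Poly_Mapping.keys w. of_rat (Poly_Mapping.lookup w u) *
      (1 / of_nat n ^ 2 * mhs n 0 u * t ^ n)) sums Li_append2 w t"
    unfolding Li_append2_def by (intro sums_sum sums_mult_nonarch Li_snoc_sums assms) simp
  thus ?thesis
    by (simp add: mhs_H1_def sum_distrib_left sum_distrib_right mult_ac)
qed

lemma hadamard_eval_neg_log_powers:
  fixes t :: 'a
  assumes "absval t < 1" "1 \<le> i" "1 \<le> j"
  shows "hadamard_eval (neg_log_fps ^ i) (neg_log_fps ^ j) t =
    fact i * fact j * Li_append2 (word (replicate (i - 1) 1) \<^bold>* word (replicate (j - 1) 1)) t"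
proof -
  let ?w = "harmonic_word (replicate (i - 1) 1) (replicate (j - 1) 1)"
  have "fps_nth (neg_log_fps ^ i) n * fps_nth (neg_log_fps ^ j) n * t ^ n =
      fact i * fact j * (1 / of_nat n ^ 2 * mhs_H1 n 0 ?w * t ^ n)" for n
    using assms(2,3) fps_nth_neg_log_power[of "i - 1" n, where ?'a = 'a]
      fps_nth_neg_log_power[of "j - 1" n, where ?'a = 'a]
    by (simp add: power2_eq_square del: power_Suc flip: mhs_mult)
  thus ?thesis
    unfolding hadamard_eval_def harmonic_word_word
    using sums_unique[OF sums_mult_nonarch[OF Li_append2_sums[OF assms(1)]]] by simp
qed

end

section \<open>Evaluation of Laurent polynomials\<close>

lemma laurent_eval_add: "laurent_eval (f + g) z = laurent_eval f z + laurent_eval g z"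
  unfolding laurent_eval_def by (rule setsum_keys_plus_distrib) (simp_all add: distrib_right)

lemma laurent_eval_0: "laurent_eval 0 z = 0"
  by (simp add: laurent_eval_def)

lemma laurent_eval_diff: "laurent_eval (f - g) z = laurent_eval f z - laurent_eval g z"
  using laurent_eval_add[of "f - g" g z] by simp

lemma laurent_eval_single:
  "laurent_eval (Poly_Mapping.single e c) z = c * (\<Prod>i\<in>UNIV. z i powi Poly_Mapping.lookup e i)"
  by (simp add: laurent_eval_def)

lemma laurent_eval_const: "laurent_eval (laurent_const c) z = c"
  by (simp add: laurent_const_def laurent_eval_single)

lemma laurent_eval_var: "laurent_eval (laurent_var i) z = z i"
proof -
  have "(\<Prod>j\<in>UNIV. z j powi Poly_Mapping.lookup (Poly_Mapping.single i 1) j) =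
      (\<Prod>j\<in>UNIV. if i = j then z j else 1)"
    by (intro prod.cong) (auto simp: lookup_single when_def)
  thus ?thesis
    by (simp add: laurent_var_def laurent_eval_single)
qed

lemma poly_mapping_single_add_induct [case_names zero single_add]:
  fixes f :: "'k \<Rightarrow>\<^sub>0 'v::monoid_add"
  assumes "P 0" "\<And>k c f. P f \<Longrightarrow> P (Poly_Mapping.single k c + f)"
  shows "P f"
proof (induction f rule: update_induct)
  case (update f k c)
  have "Poly_Mapping.update k c f = Poly_Mapping.single k c + f"
    using update(1)
    by (intro poly_mapping_eqI)
      (auto simp: lookup_update lookup_add lookup_single in_keys_iff when_def)
  thus ?case
    using assms(2) update(3) by simp
qed (rule assms(1))

lemma laurent_eval_single_mult:
  assumes "\<And>i. z i \<noteq> 0"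
  shows "laurent_eval (Poly_Mapping.single e c * g) z =
    laurent_eval (Poly_Mapping.single e c) z * laurent_eval g z"
proof (induction g rule: poly_mapping_single_add_induct)
  case (single_add e' c' g)
  have "(\<Prod>i\<in>UNIV. z i powi Poly_Mapping.lookup (e + e') i) =
      (\<Prod>i\<in>UNIV. z i powi Poly_Mapping.lookup e i) * (\<Prod>i\<in>UNIV. z i powi Poly_Mapping.lookup e' i)"
    using assms by (simp add: lookup_add power_int_add prod.distrib)
  hence "laurent_eval (Poly_Mapping.single (e + e') (c * c')) z =
      laurent_eval (Poly_Mapping.single e c) z * laurent_eval (Poly_Mapping.single e' c') z"
    by (simp add: laurent_eval_single mult_ac)
  thus ?case
    by (simp add: distrib_left mult_single laurent_eval_add single_add)
qed (simp add: laurent_eval_0)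

lemma laurent_eval_mult:
  assumes "\<And>i. z i \<noteq> 0"
  shows "laurent_eval (f * g) z = laurent_eval f z * laurent_eval g z"
proof (induction f rule: poly_mapping_single_add_induct)
  case (single_add e c f)
  thus ?case
    by (simp add: distrib_right laurent_eval_add laurent_eval_single_mult[OF assms])
qed (simp add: laurent_eval_0)

section \<open>The higher Mahler measure of a quadratic polynomial\<close>

definition trinomial :: "nat \<Rightarrow> nat \<Rightarrow> nat \<Rightarrow> 'a::field_char_0" where
  "trinomial k i j = fact k / (fact i * fact j * fact (k - i - j))"

lemma trinomial_expansion:
  fixes a b c :: "'a::field_char_0"
  shows "(a + b + c) ^ k = (\<Sum>(i, j) | i + j \<le> k.
    trinomial k i j * a ^ (k - i - j) * (b ^ i * c ^ j))"
proof -
  have "(a + b + c) ^ k = (b + (c + a)) ^ k"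
    by (simp add: add_ac)
  also have "\<dots> = (\<Sum>i\<le>k. of_nat (k choose i) * b ^ i * (c + a) ^ (k - i))"
    by (rule binomial_ring)
  also have "\<dots> = (\<Sum>i\<le>k. \<Sum>j\<le>k - i. of_nat (k choose i) * b ^ i *
      (of_nat ((k - i) choose j) * c ^ j * a ^ (k - i - j)))"
    by (simp add: binomial_ring sum_distrib_left)
  also have "\<dots> = (\<Sum>i\<le>k. \<Sum>j\<le>k - i.
      trinomial k i j * a ^ (k - i - j) * (b ^ i * c ^ j))"
    by (intro sum.cong refl) (simp add: trinomial_def binomial_fact field_simps)
  also have "\<dots> = (\<Sum>(i, j)\<in>Sigma {..k} (\<lambda>i. {..k - i}).
      trinomial k i j * a ^ (k - i - j) * (b ^ i * c ^ j))"
    by (rule sum.Sigma) auto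
  also have "Sigma {..k} (\<lambda>i. {..k - i}) = {(i, j). i + j \<le> k}"
    by auto
  finally show ?thesis .
qed

lemma finite_pairs_sum_le: "finite {(i :: nat, j). i + j \<le> k}"
  by (rule finite_subset[of _ "{..k} \<times> {..k}"]) auto

lemma sum_triangle_split_boundary:
  fixes T :: "nat \<Rightarrow> nat \<Rightarrow> 'b::comm_monoid_add"
  assumes "\<And>i. i > 0 \<Longrightarrow> T i 0 = 0" "\<And>j. j > 0 \<Longrightarrow> T 0 j = 0"
  shows "(\<Sum>(i, j) | i + j \<le> k. T i j) = T 0 0 + (\<Sum>(i, j) | 1 \<le> i \<and> 1 \<le> j \<and> i + j \<le> k. T i j)"
proof -
  have interior: "1 \<le> i \<and> 1 \<le> j" if "T i j \<noteq> 0" "(i, j) \<noteq> (0, 0)" for i j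
    using that assms by (cases i; cases j) auto
  have "(\<Sum>(i, j) | i + j \<le> k. T i j) = T 0 0 + (\<Sum>(i, j)\<in>{(i, j). i + j \<le> k} - {(0, 0)}. T i j)"
    using finite_pairs_sum_le by (subst sum.remove[of _ "(0, 0)"]) auto
  also have "(\<Sum>(i, j)\<in>{(i, j). i + j \<le> k} - {(0, 0)}. T i j) =
      (\<Sum>(i, j) | 1 \<le> i \<and> 1 \<le> j \<and> i + j \<le> k. T i j)"
    using finite_pairs_sum_le by (intro sum.mono_neutral_right) (auto dest: interior)
  finally show ?thesis .
qed

lemma (in padic_field) mahler_measure_p_eqI:
  fixes f :: "(unit, 'a) laurent"
  assumes "((\<lambda>N. mu_mean N (\<lambda>\<zeta>. log_p p pw (laurent_eval f (\<lambda>_. \<zeta>)) ^ k)) \<longlongrightarrow> l) coprime_at_top"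
  shows "mahler_measure_p p pw k f = l"
proof -
  have "(\<Sum>\<zeta> | \<forall>i. \<zeta> i \<in> mu N. log_p p pw (laurent_eval f \<zeta>) ^ k) / of_nat N ^ CARD(unit) =
      mu_mean N (\<lambda>\<zeta>. log_p p pw (laurent_eval f (\<lambda>_. \<zeta>)) ^ k)" for N
  proof -
    have "(\<Sum>\<zeta> | \<forall>i. \<zeta> i \<in> mu N. log_p p pw (laurent_eval f \<zeta>) ^ k) =
        (\<Sum>\<zeta>\<in>mu N. log_p p pw (laurent_eval f (\<lambda>_. \<zeta>)) ^ k)"
      by (rule sum.reindex_bij_witness[of _ "\<lambda>\<zeta> _. \<zeta>" "\<lambda>\<zeta>. \<zeta> ()"]) auto
    thus ?thesis
      by (simp add: mu_mean_def)
  qed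
  with assms show ?thesis
    unfolding mahler_measure_p_def by (intro tendsto_Lim[OF coprime_at_top_neq_bot]) simp
qed

context Cp_field
begin

lemma mu_mean_log_powers_tendsto:
  fixes \<alpha> \<beta> :: 'a
  assumes "absval \<beta> < 1" "1 < absval \<alpha>"
  shows "((\<lambda>N. mu_mean N (\<lambda>\<zeta>. log_U0 (1 - \<zeta> / \<alpha>) ^ i * log_U0 (1 - \<beta> / \<zeta>) ^ j)) \<longlongrightarrow>
    (-1) ^ (i + j) * hadamard_eval (neg_log_fps ^ i) (neg_log_fps ^ j) (\<beta> / \<alpha>)) coprime_at_top"
proof -
  have "\<alpha> \<noteq> 0"
    using assms(2) by auto
  define a where "a n = fps_nth (neg_log_fps ^ i) n * (1 / \<alpha>) ^ n" for n
  define b where "b n = fps_nth (neg_log_fps ^ j) n * \<beta> ^ n" for n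
  have "((\<lambda>N. mu_mean N (\<lambda>\<zeta>. (- log_U0 (1 - \<zeta> / \<alpha>)) ^ i * (- log_U0 (1 - \<beta> / \<zeta>)) ^ j)) \<longlongrightarrow>
      suminf (\<lambda>n. a n * b n)) coprime_at_top"
  proof (rule mu_mean_mult_tendsto)
    fix \<zeta> :: 'a assume "absval \<zeta> = 1"
    hence "absval (\<zeta> / \<alpha>) < 1" "absval (\<beta> / \<zeta>) < 1"
      using assms \<open>\<alpha> \<noteq> 0\<close> by (simp_all add: absval_divide)
    thus "(\<lambda>n. a n * \<zeta> ^ n) sums (- log_U0 (1 - \<zeta> / \<alpha>)) ^ i"
      "(\<lambda>n. b n * inverse \<zeta> ^ n) sums (- log_U0 (1 - \<beta> / \<zeta>)) ^ j"
      using log_U0_power_sums[of "\<zeta> / \<alpha>" i] log_U0_power_sums[of "\<beta> / \<zeta>" j]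
      by (simp_all add: a_def b_def power_mult_distrib power_inverse divide_inverse mult_ac)
  qed
  also have "(\<lambda>n. a n * b n) =
      (\<lambda>n. fps_nth (neg_log_fps ^ i) n * fps_nth (neg_log_fps ^ j) n * (\<beta> / \<alpha>) ^ n)"
    by (simp add: a_def b_def power_divide mult_ac)
  finally have "((\<lambda>N. (-1) ^ (i + j) *
      mu_mean N (\<lambda>\<zeta>. (- log_U0 (1 - \<zeta> / \<alpha>)) ^ i * (- log_U0 (1 - \<beta> / \<zeta>)) ^ j)) \<longlongrightarrow>
      (-1) ^ (i + j) * hadamard_eval (neg_log_fps ^ i) (neg_log_fps ^ j) (\<beta> / \<alpha>)) coprime_at_top"
    unfolding hadamard_eval_def by (intro tendsto_mult tendsto_const)
  moreover have "(-1) ^ (i + j) * ((- x) ^ i * (- y) ^ j) = x ^ i * y ^ j" for x y :: 'a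
    by (simp add: power_add power_minus[of x] power_minus[of y] mult_ac)
  ultimately show ?thesis
    by (simp flip: mu_mean_mult)
qed

lemma log_p_quadratic_power:
  assumes "coprime N p" "N > 0" "\<zeta> \<in> mu N" "absval \<beta> < 1" "1 < absval \<alpha>"
  shows "log_p p pw ((\<zeta> - \<alpha>) * (\<zeta> - \<beta>)) ^ k =
    (\<Sum>(i, j) | i + j \<le> k. trinomial k i j * log_p p pw \<alpha> ^ (k - i - j) *
      (log_U0 (1 - \<zeta> / \<alpha>) ^ i * log_U0 (1 - \<beta> / \<zeta>) ^ j))"
proof -
  have "absval \<zeta> = 1"
    using absval_mu_ur mu_subset_mu_ur[OF assms(1,2)] assms(3) by blast
  moreover have "\<alpha> \<noteq> 0"
    using assms(5) by auto
  ultimately have "log_p p pw ((\<zeta> - \<alpha>) * (\<zeta> - \<beta>)) =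
      log_p p pw \<alpha> + log_U0 (1 - \<zeta> / \<alpha>) + log_U0 (1 - \<beta> / \<zeta>)"
    using assms by (intro log_p_quadratic) (simp_all add: absval_divide)
  thus ?thesis
    by (simp only: trinomial_expansion)
qed

lemma mu_mean_log_p_quadratic_tendsto:
  fixes \<alpha> \<beta> :: 'a
  assumes "absval \<beta> < 1" "1 < absval \<alpha>"
  shows "((\<lambda>N. mu_mean N (\<lambda>\<zeta>. log_p p pw ((\<zeta> - \<alpha>) * (\<zeta> - \<beta>)) ^ k)) \<longlongrightarrow>
    (\<Sum>(i, j) | i + j \<le> k. trinomial k i j * log_p p pw \<alpha> ^ (k - i - j) *
      ((-1) ^ (i + j) * hadamard_eval (neg_log_fps ^ i) (neg_log_fps ^ j) (\<beta> / \<alpha>)))) coprime_at_top"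
proof -
  define c where "c i j = trinomial k i j * log_p p pw \<alpha> ^ (k - i - j)"
    for i j
  let ?logs = "\<lambda>i j \<zeta>. log_U0 (1 - \<zeta> / \<alpha>) ^ i * log_U0 (1 - \<beta> / \<zeta>) ^ j"
  have "((\<lambda>N. \<Sum>(i, j) | i + j \<le> k. c i j * mu_mean N (?logs i j)) \<longlongrightarrow>
      (\<Sum>(i, j) | i + j \<le> k. c i j *
        ((-1) ^ (i + j) * hadamard_eval (neg_log_fps ^ i) (neg_log_fps ^ j) (\<beta> / \<alpha>))))
      coprime_at_top"
    unfolding case_prod_unfold
    by (intro tendsto_sum tendsto_mult tendsto_const mu_mean_log_powers_tendsto assms)
  moreover have "\<forall>\<^sub>F N in coprime_at_top. (\<Sum>(i, j) | i + j \<le> k. c i j * mu_mean N (?logs i j)) =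
      mu_mean N (\<lambda>\<zeta>. log_p p pw ((\<zeta> - \<alpha>) * (\<zeta> - \<beta>)) ^ k)"
  proof (rule eventually_coprime_at_topI[of 0])
    fix N assume N: "coprime N p" "N > 0"
    have "mu_mean N (\<lambda>\<zeta>. log_p p pw ((\<zeta> - \<alpha>) * (\<zeta> - \<beta>)) ^ k) =
        mu_mean N (\<lambda>\<zeta>. \<Sum>(i, j) | i + j \<le> k. c i j * ?logs i j \<zeta>)"
      unfolding c_def using N assms by (intro mu_mean_cong log_p_quadratic_power)
    thus "(\<Sum>(i, j) | i + j \<le> k. c i j * mu_mean N (?logs i j)) =
        mu_mean N (\<lambda>\<zeta>. log_p p pw ((\<zeta> - \<alpha>) * (\<zeta> - \<beta>)) ^ k)"
      by (simp add: case_prod_unfold mu_mean_sum mu_mean_mult)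
  qed
  ultimately show ?thesis
    unfolding c_def by (rule Lim_transform_eventually)
qed

lemma mahler_measure_p_quadratic:
  fixes \<alpha> \<beta> :: 'a
  assumes "absval \<beta> < 1" "1 < absval \<alpha>"
  shows "mahler_measure_p p pw k
      ((laurent_var () - laurent_const \<alpha>) * (laurent_var () - laurent_const \<beta>)) =
    (\<Sum>(i, j) | i + j \<le> k. trinomial k i j * log_p p pw \<alpha> ^ (k - i - j) *
      ((-1) ^ (i + j) * hadamard_eval (neg_log_fps ^ i) (neg_log_fps ^ j) (\<beta> / \<alpha>)))"
proof (rule mahler_measure_p_eqI, rule Lim_transform_eventually)
  let ?f = "(laurent_var () - laurent_const \<alpha>) * (laurent_var () - laurent_const \<beta>)"
  show "\<forall>\<^sub>F N in coprime_at_top. mu_mean N (\<lambda>\<zeta>. log_p p pw ((\<zeta> - \<alpha>) * (\<zeta> - \<beta>)) ^ k) =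
      mu_mean N (\<lambda>\<zeta>. log_p p pw (laurent_eval ?f (\<lambda>_. \<zeta>)) ^ k)"
    by (rule eventually_coprime_at_topI[of 0], rule mu_mean_cong)
      (simp add: laurent_eval_mult laurent_eval_diff laurent_eval_var laurent_eval_const mu_nonzero)
qed (rule mu_mean_log_p_quadratic_tendsto[OF assms])

end

theorem theorem1p5:
  fixes p :: nat and pw :: "rat \<Rightarrow> 'a::nonarch_complete_field" and \<alpha> \<beta> :: 'a and k :: nat
  assumes "prime p"
    and "is_Cp p TYPE('a)"
    and "is_p_power p pw"
    and "0 < absval \<beta>" and "absval \<beta> < 1" and "1 < absval \<alpha>"
    and "1 \<le> k"
  shows "mahler_measure_p p pw k
           ((laurent_var () - laurent_const \<alpha>) * (laurent_var () - laurent_const \<beta>)) =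
         log_p p pw \<alpha> ^ k +
         (\<Sum>(i, j) | 1 \<le> i \<and> 1 \<le> j \<and> i + j \<le> k.
            (-1) ^ (i + j) * (fact k / fact (k - i - j)) * log_p p pw \<alpha> ^ (k - i - j) *
            Li_append2 (word (replicate (i - 1) 1) \<^bold>* word (replicate (j - 1) 1)) (\<beta> / \<alpha>))"
proof -
  interpret Cp_field p "TYPE('a)" pw
    using assms(1-3) by unfold_locales (auto simp: is_Cp_def)
  define T where "T i j = trinomial k i j * log_p p pw \<alpha> ^ (k - i - j) *
    ((-1) ^ (i + j) * hadamard_eval (neg_log_fps ^ i) (neg_log_fps ^ j) (\<beta> / \<alpha>))" for i j
  have boundary: "T i j = (if i = j then log_p p pw \<alpha> ^ k else 0)" if "i = 0 \<or> j = 0" for i j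
    using that by (auto simp: T_def trinomial_def hadamard_eval_neg_log_powers_boundary)
  have "absval (\<beta> / \<alpha>) < 1"
    using assms(5,6) by (auto simp: absval_divide divide_less_eq)
  hence interior: "T i j =
      (-1) ^ (i + j) * (fact k / fact (k - i - j)) * log_p p pw \<alpha> ^ (k - i - j) *
      Li_append2 (word (replicate (i - 1) 1) \<^bold>* word (replicate (j - 1) 1)) (\<beta> / \<alpha>)"
    if "1 \<le> i" "1 \<le> j" for i j
    using that by (simp add: T_def trinomial_def hadamard_eval_neg_log_powers field_simps)
  have "mahler_measure_p p pw k
      ((laurent_var () - laurent_const \<alpha>) * (laurent_var () - laurent_const \<beta>)) =
      (\<Sum>(i, j) | i + j \<le> k. T i j)"
    unfolding T_def by (rule mahler_measure_p_quadratic[OF assms(5,6)])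
  also have "\<dots> = T 0 0 + (\<Sum>(i, j) | 1 \<le> i \<and> 1 \<le> j \<and> i + j \<le> k. T i j)"
    by (rule sum_triangle_split_boundary) (simp_all add: boundary)
  finally show ?thesis
    by (simp add: boundary interior case_prod_unfold)
qed

end
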